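(* The flow $(|\mathcal{W}|,T)$ is strictly ergodic. Hence every function in $\mathcal{W}$ is strictly ergodic; i.e., for every $f\in\mathcal{W}$ the flow $(X_f,T)$ is strictly ergodic.
   Context: A flow $(X,T)$ is a compact Hausdorff space $X$ with a self-homeomorphism $T:X\to X$; it is minimal if every orbit $\{T^nx:n\in\mathbb{Z}\}$ is dense. It is uniquely ergodic if it has exactly one $T$-invariant (regular) Borel probability measure, and strictly ergodic if it is uniquely ergodic and minimal. A $T$-subalgebra of $\ell^\infty(\mathbb{Z})$ (complex-valued bounded functions) is a uniformly closed, translation invariant subalgebra closed under complex conjugation (and containing the constants). The Weyl algebra $\mathcal{W}$ is the smallest $T$-subalgebra of $\ell^\infty(\mathbb{Z})$ containing all functions $n\mapsto e^{2\pi i n^k\alpha}$, $\alpha\in\mathbb{R}$, $k\in\mathbb{N}$. For a $T$-subalgebra $\mathcal{A}$, $|\mathcal{A}|$ denotes its Gelfand space (space of multiplicative functionals), and $T$ on $|\mathcal{A}|$ is the homeomorphism induced by translation $f(\cdot)\mapsto f(\cdot+1)$ on $\mathcal{A}$. For $f\in\ell^\infty(\mathbb{Z})$, $X_f$ is the closure, in the product topology (pointwise convergence), of the set of translates $\{f(\cdot+k):k\in\mathbb{Z}\}$, with $T$ acting by the shift $(Tg)(n)=g(n+1)$. *)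

theory Defs
  imports "HOL-Probability.Probability"
begin

section \<open>Flows\<close>

definition is_flow :: "'a topology \<Rightarrow> ('a \<Rightarrow> 'a) \<Rightarrow> bool" where
  "is_flow X T \<longleftrightarrow> compact_space X \<and> Hausdorff_space X \<and> homeomorphic_map X X T"

text \<open>The map \<open>T\<close> is only relevant on the carrier of the space, so negative powers
  are powers of its inverse there.\<close>

definition flow_power :: "'a topology \<Rightarrow> ('a \<Rightarrow> 'a) \<Rightarrow> int \<Rightarrow> 'a \<Rightarrow> 'a" where
  "flow_power X T n =
     (if 0 \<le> n then T ^^ nat n else inv_into (topspace X) T ^^ nat (- n))"

definition minimal_flow :: "'a topology \<Rightarrow> ('a \<Rightarrow> 'a) \<Rightarrow> bool" where
  "minimal_flow X T \<longleftrightarrow> is_flow X T \<and>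
     (\<forall>x\<in>topspace X. X closure_of (range (\<lambda>n. flow_power X T n x)) = topspace X)"

definition borel_of_topology :: "'a topology \<Rightarrow> 'a measure" where
  "borel_of_topology X = sigma (topspace X) {U. openin X U}"

definition regular_measure :: "'a topology \<Rightarrow> 'a measure \<Rightarrow> bool" where
  "regular_measure X M \<longleftrightarrow>
     (\<forall>B\<in>sets M.
        emeasure M B = (INF U\<in>{U. openin X U \<and> B \<subseteq> U}. emeasure M U) \<and>
        emeasure M B = (SUP K\<in>{K. compactin X K \<and> K \<subseteq> B}. emeasure M K))"

definition invariant_probability :: "'a topology \<Rightarrow> ('a \<Rightarrow> 'a) \<Rightarrow> 'a measure \<Rightarrow> bool" where
  "invariant_probability X T M \<longleftrightarrow>
     prob_space M \<and> sets M = sets (borel_of_topology X) \<and> regular_measure X M \<and>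
     (\<forall>B\<in>sets M. emeasure M (T -` B \<inter> topspace X) = emeasure M B)"

definition uniquely_ergodic :: "'a topology \<Rightarrow> ('a \<Rightarrow> 'a) \<Rightarrow> bool" where
  "uniquely_ergodic X T \<longleftrightarrow> is_flow X T \<and> (\<exists>!M. invariant_probability X T M)"

definition strictly_ergodic :: "'a topology \<Rightarrow> ('a \<Rightarrow> 'a) \<Rightarrow> bool" where
  "strictly_ergodic X T \<longleftrightarrow> uniquely_ergodic X T \<and> minimal_flow X T"


section \<open>Translation-invariant subalgebras of the bounded functions on the integers\<close>

definition linf :: "(int \<Rightarrow> complex) set" where
  "linf = {f. bounded (range f)}"

definition T_subalgebra :: "(int \<Rightarrow> complex) set \<Rightarrow> bool" where
  "T_subalgebra A \<longleftrightarrow>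
     A \<subseteq> linf \<and>
     (\<forall>c. (\<lambda>_. c) \<in> A) \<and>
     (\<forall>f\<in>A. \<forall>g\<in>A. (\<lambda>n. f n + g n) \<in> A) \<and>
     (\<forall>f\<in>A. \<forall>g\<in>A. (\<lambda>n. f n * g n) \<in> A) \<and>
     (\<forall>c. \<forall>f\<in>A. (\<lambda>n. c * f n) \<in> A) \<and>
     (\<forall>f\<in>A. (\<lambda>n. cnj (f n)) \<in> A) \<and>
     (\<forall>f\<in>A. \<forall>k. (\<lambda>n. f (n + k)) \<in> A) \<and>
     (\<forall>F f. (\<forall>i::nat. F i \<in> A) \<and> uniform_limit UNIV F f sequentially \<longrightarrow> f \<in> A)"

definition weyl_generators :: "(int \<Rightarrow> complex) set" where
  "weyl_generators =
     {(\<lambda>n. exp (2 * of_real pi * \<i> * of_int (n ^ k) * of_real \<alpha>)) | (k::nat) (\<alpha>::real). True}"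

definition weyl_algebra :: "(int \<Rightarrow> complex) set" where
  "weyl_algebra = \<Inter>{A. T_subalgebra A \<and> weyl_generators \<subseteq> A}"

lemma linfI: "(\<And>n. cmod (f n) \<le> C) \<Longrightarrow> f \<in> linf"
  by (auto simp: linf_def bounded_iff)

lemma linfE:
  assumes "f \<in> linf"
  obtains C where "\<And>n. cmod (f n) \<le> C"
  using assms by (auto simp: linf_def bounded_iff)

lemma T_subalgebraI:
  assumes "A \<subseteq> linf"
    and "\<And>c. (\<lambda>_. c) \<in> A"
    and "\<And>f g. f \<in> A \<Longrightarrow> g \<in> A \<Longrightarrow> (\<lambda>n. f n + g n) \<in> A"
    and "\<And>f g. f \<in> A \<Longrightarrow> g \<in> A \<Longrightarrow> (\<lambda>n. f n * g n) \<in> A"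
    and "\<And>f. f \<in> A \<Longrightarrow> (\<lambda>n. cnj (f n)) \<in> A"
    and "\<And>f k. f \<in> A \<Longrightarrow> (\<lambda>n. f (n + k)) \<in> A"
    and "\<And>F f. (\<And>i::nat. F i \<in> A) \<Longrightarrow> uniform_limit UNIV F f sequentially \<Longrightarrow> f \<in> A"
  shows "T_subalgebra A"
proof -
  have "(\<lambda>n. c * f n) \<in> A" if "f \<in> A" for c f
    by (rule assms(4)[OF assms(2) that])
  moreover have "f \<in> A" if "(\<forall>i::nat. F i \<in> A) \<and> uniform_limit UNIV F f sequentially" for F f
    using that by (intro assms(7)[of F f]) (rule spec[OF conjunct1], assumption, rule conjunct2)
  ultimately show ?thesis
    unfolding T_subalgebra_def
    by (intro conjI ballI allI impI) (rule assms(1-6) | assumption)+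
qed

lemma T_subalgebra_linf: "T_subalgebra linf"
proof (rule T_subalgebraI)
  show "(\<lambda>_. c) \<in> linf" for c
    by (simp add: linf_def)
next
  fix f g assume fg: "f \<in> linf" "g \<in> linf"
  obtain C where C: "\<And>n. cmod (f n) \<le> C"
    using linfE[OF fg(1)] by blast
  obtain D where D: "\<And>n. cmod (g n) \<le> D"
    using linfE[OF fg(2)] by blast
  have "cmod (f n + g n) \<le> C + D" for n
    by (intro norm_triangle_le add_mono C D)
  then show "(\<lambda>n. f n + g n) \<in> linf"
    by (rule linfI)
  have "cmod (f n * g n) \<le> C * D" for n
    unfolding norm_mult by (intro mult_mono' C D norm_ge_zero)
  then show "(\<lambda>n. f n * g n) \<in> linf"
    by (rule linfI)
next
  fix f and k :: int assume f: "f \<in> linf"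
  obtain C where C: "\<And>n. cmod (f n) \<le> C"
    using linfE[OF f] by blast
  show "(\<lambda>n. f (n + k)) \<in> linf"
    by (rule linfI) (rule C)
  show "(\<lambda>n. cnj (f n)) \<in> linf"
    by (rule linfI[of _ C]) (simp add: C)
next
  fix F :: "nat \<Rightarrow> int \<Rightarrow> complex" and f
  assume F: "\<And>i. F i \<in> linf" and lim: "uniform_limit UNIV F f sequentially"
  from lim have "\<forall>\<^sub>F i in sequentially. \<forall>n\<in>UNIV. dist (F i n) (f n) < 1"
    by (rule uniform_limitD) simp
  then obtain i where i: "\<And>n. dist (F i n) (f n) < 1"
    by (auto simp: eventually_sequentially)
  obtain C where C: "\<And>n. cmod (F i n) \<le> C"
    using linfE[OF F] by blast
  have "cmod (f n) \<le> C + 1" for n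
    using i[of n] C[of n] norm_triangle_sub[of "f n" "F i n"]
    by (simp add: dist_norm norm_minus_commute)
  then show "f \<in> linf"
    by (rule linfI)
qed simp

lemma weyl_generators_subset_linf: "weyl_generators \<subseteq> linf"
proof
  fix f assume "f \<in> weyl_generators"
  then obtain k \<alpha> where
    "f = (\<lambda>n. exp (2 * of_real pi * \<i> * of_int (n ^ k) * of_real \<alpha>))"
    by (auto simp: weyl_generators_def)
  then have "cmod (f n) \<le> 1" for n
    by (simp add: norm_exp)
  then show "f \<in> linf"
    by (rule linfI)
qed

lemma T_subalgebra_weyl_algebra: "T_subalgebra weyl_algebra"
proof (rule T_subalgebraI)
  show "weyl_algebra \<subseteq> linf"
    using T_subalgebra_linf weyl_generators_subset_linf by (auto simp: weyl_algebra_def)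
next
  fix F :: "nat \<Rightarrow> int \<Rightarrow> complex" and f
  assume F: "\<And>i. F i \<in> weyl_algebra" and lim: "uniform_limit UNIV F f sequentially"
  show "f \<in> weyl_algebra"
    unfolding weyl_algebra_def
  proof
    fix A assume A: "A \<in> {A. T_subalgebra A \<and> weyl_generators \<subseteq> A}"
    then have "F i \<in> A" for i
      using F[of i] by (auto simp: weyl_algebra_def)
    with A lim show "f \<in> A"
      unfolding T_subalgebra_def by blast
  qed
qed (simp_all add: weyl_algebra_def T_subalgebra_def)

lemma weyl_generators_subset_weyl_algebra: "weyl_generators \<subseteq> weyl_algebra"
  by (auto simp: weyl_algebra_def)

lemma weyl_algebra_least:
  "T_subalgebra A \<Longrightarrow> weyl_generators \<subseteq> A \<Longrightarrow> weyl_algebra \<subseteq> A"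
  by (auto simp: weyl_algebra_def)


section \<open>The Gelfand space\<close>

text \<open>A functional on \<open>A\<close> is represented by a function that is \<open>undefined\<close> outside \<open>A\<close>.\<close>

definition multiplicative_functionals ::
    "(int \<Rightarrow> complex) set \<Rightarrow> ((int \<Rightarrow> complex) \<Rightarrow> complex) set" where
  "multiplicative_functionals A =
     {\<phi> \<in> extensional A.
        (\<forall>f\<in>A. \<forall>g\<in>A. \<phi> (\<lambda>n. f n + g n) = \<phi> f + \<phi> g) \<and>
        (\<forall>c. \<forall>f\<in>A. \<phi> (\<lambda>n. c * f n) = c * \<phi> f) \<and>
        (\<forall>f\<in>A. \<forall>g\<in>A. \<phi> (\<lambda>n. f n * g n) = \<phi> f * \<phi> g) \<and>
        (\<exists>f\<in>A. \<phi> f \<noteq> 0)}"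

text \<open>The topology of pointwise convergence on \<open>A\<close>, i.e. the weak-* topology.\<close>

definition gelfand_space ::
    "(int \<Rightarrow> complex) set \<Rightarrow> ((int \<Rightarrow> complex) \<Rightarrow> complex) topology" where
  "gelfand_space A =
     subtopology (product_topology (\<lambda>_. euclidean) A) (multiplicative_functionals A)"

definition gelfand_shift ::
    "(int \<Rightarrow> complex) set \<Rightarrow> ((int \<Rightarrow> complex) \<Rightarrow> complex) \<Rightarrow> (int \<Rightarrow> complex) \<Rightarrow> complex" where
  "gelfand_shift A \<phi> = (\<lambda>f\<in>A. \<phi> (\<lambda>n. f (n + 1)))"

lemma topspace_gelfand_space: "topspace (gelfand_space A) = multiplicative_functionals A"
  by (auto simp: gelfand_space_def multiplicative_functionals_def PiE_def)


section \<open>The flow generated by a function\<close>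

definition shift :: "(int \<Rightarrow> complex) \<Rightarrow> int \<Rightarrow> complex" where
  "shift g = (\<lambda>n. g (n + 1))"

text \<open>The library topology on the function type \<open>int \<Rightarrow> complex\<close> is the product topology.\<close>

definition orbit_closure :: "(int \<Rightarrow> complex) \<Rightarrow> (int \<Rightarrow> complex) set" where
  "orbit_closure f = closure (range (\<lambda>k n. f (n + k)))"

definition strictly_ergodic_function :: "(int \<Rightarrow> complex) \<Rightarrow> bool" where
  "strictly_ergodic_function f \<longleftrightarrow> strictly_ergodic (top_of_set (orbit_closure f)) shift"

end

theory Submission
  imports Defs
begin

text \<open>
  Every function in the Weyl algebra is a uniform limit of trigonometric polynomials
  \<open>n \<mapsto> \<Sum> c\<^sub>p e(p(n))\<close> with real polynomials \<open>p\<close>, and two facts about such functions carry the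
  theorem.

  First, averages over windows \<open>[k, k + N)\<close> converge, uniformly in \<open>k\<close>, to a constant
  (\<open>weyl_has_uniform_mean\<close>). For a single phase \<open>e(p(n))\<close> this is Weyl's argument: if every
  nonconstant coefficient is rational the phase is periodic, and otherwise van der Corput
  differencing lowers the highest index of an irrational coefficient until a linear term is
  reached.

  Second, finitely many functions of the algebra return simultaneously close to their values at
  any point along a syndetic set of times (\<open>weyl_returns_syndetic\<close>). For phases this is distality:
  restricted to polynomials of degree at most \<open>d\<close>, the shift is a compact group extension of its
  restriction to degree below \<open>d\<close>, and minimality lifts through such an extension because the
  powers of an element of a compact group come back to the identity.

  The flow on the Gelfand space and the flows \<open>X\<^sub>f\<close> have the same form: the closure \<open>X\<close>, in a
  product of copies of the complex plane, of the points \<open>(h\<^sub>i(n))\<^sub>i\<close>, with \<open>h\<^sub>i\<close> in the algebra and the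
  shift acting by a permutation of the indices. For \<open>X\<^sub>f\<close> the \<open>h\<^sub>i\<close> are the translates of \<open>f\<close>; for the
  Gelfand space the index set is the algebra itself, since a multiplicative functional that were
  not a limit of evaluations would annihilate an invertible element
  (\<open>multiplicative_functionals_eq_closure\<close>).

  For such an \<open>X\<close>, Stone--Weierstrass shows that a continuous function \<open>g\<close> on \<open>X\<close>, read along the
  dense orbit, lies in the algebra (\<open>continuous_function_along_orbit\<close>). Hence the averages of \<open>g\<close>
  along the shift converge uniformly on \<open>X\<close> to a constant, and this constant must be the integral
  of \<open>g\<close> against any invariant probability measure. Regular measures with equal integrals of
  continuous functions are equal, which gives uniqueness. For existence the mean value is a
  positive normalised functional, and an outer measure is built from it as in the Riesz
  representation theorem (\<open>representing_measure_invariant\<close>); the Gelfand space is not metrizable,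
  so regularity has to be carried along. Minimality is the second fact above, transported to \<open>X\<close>.
\<close>


section \<open>Window averages and uniform means\<close>

definition window_average :: "(int \<Rightarrow> complex) \<Rightarrow> nat \<Rightarrow> int \<Rightarrow> complex" where
  "window_average f N k = (\<Sum>j<N. f (k + int j)) / of_nat N"

definition has_uniform_mean :: "(int \<Rightarrow> complex) \<Rightarrow> complex \<Rightarrow> bool" where
  "has_uniform_mean f c \<longleftrightarrow> uniform_limit UNIV (window_average f) (\<lambda>_. c) sequentially"

lemma has_uniform_meanI:
  assumes "\<And>e. e > 0 \<Longrightarrow> \<forall>\<^sub>F N in sequentially. \<forall>k. cmod (window_average f N k - c) < e"
  shows "has_uniform_mean f c"
  using assms unfolding has_uniform_mean_def by (auto intro!: uniform_limitI simp: dist_norm)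

lemma has_uniform_meanD:
  assumes "has_uniform_mean f c" "e > 0"
  shows "\<forall>\<^sub>F N in sequentially. \<forall>k. cmod (window_average f N k - c) < e"
  using uniform_limitD[OF assms[unfolded has_uniform_mean_def]] by (simp add: dist_norm)

lemma window_average_diff_le:
  assumes "\<And>n. cmod (f n - g n) \<le> e" "e \<ge> 0"
  shows "cmod (window_average f N k - window_average g N k) \<le> e"
proof (cases "N = 0")
  case False
  have "window_average f N k - window_average g N k = (\<Sum>j<N. f (k + int j) - g (k + int j)) / of_nat N"
    by (simp add: window_average_def diff_divide_distrib sum_subtractf)
  moreover have "cmod (\<Sum>j<N. f (k + int j) - g (k + int j)) \<le> real N * e"
    using sum_norm_bound[of "{..<N}" "\<lambda>j. f (k + int j) - g (k + int j)" e] assms(1) by simp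
  ultimately show ?thesis
    using False by (simp add: norm_divide divide_le_eq mult.commute)
qed (simp add: window_average_def assms)

lemma has_uniform_mean_const: "has_uniform_mean (\<lambda>_. c) c"
proof (rule has_uniform_meanI)
  fix e :: real assume "e > 0"
  then show "\<forall>\<^sub>F N in sequentially. \<forall>k. cmod (window_average (\<lambda>_. c) N k - c) < e"
    unfolding eventually_sequentially by (intro exI[of _ 1]) (simp add: window_average_def)
qed

lemma has_uniform_mean_add:
  assumes "has_uniform_mean f a" "has_uniform_mean g b"
  shows "has_uniform_mean (\<lambda>n. f n + g n) (a + b)"
proof -
  have "window_average (\<lambda>n. f n + g n) = (\<lambda>N k. window_average f N k + window_average g N k)"
    by (simp add: fun_eq_iff window_average_def sum.distrib add_divide_distrib)
  then show ?thesis
    using assms unfolding has_uniform_mean_def by (simp add: uniform_limit_add)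
qed

lemma has_uniform_mean_cmult:
  assumes "has_uniform_mean f a"
  shows "has_uniform_mean (\<lambda>n. c * f n) (c * a)"
proof (rule has_uniform_meanI)
  fix e :: real assume "e > 0"
  then have "e / (cmod c + 1) > 0"
    by (simp add: add_nonneg_pos)
  from has_uniform_meanD[OF assms this]
  show "\<forall>\<^sub>F N in sequentially. \<forall>k. cmod (window_average (\<lambda>n. c * f n) N k - c * a) < e"
  proof eventually_elim
    case (elim N)
    show ?case
    proof
      fix k
      have "window_average (\<lambda>n. c * f n) N k - c * a = c * (window_average f N k - a)"
        by (simp add: window_average_def sum_distrib_left right_diff_distrib)
      then have "cmod (window_average (\<lambda>n. c * f n) N k - c * a)
          = cmod c * cmod (window_average f N k - a)"
        by (simp add: norm_mult)
      also have "\<dots> \<le> (cmod c + 1) * cmod (window_average f N k - a)"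
        by (simp add: mult_right_mono)
      also have "\<dots> < e"
        using elim[rule_format, of k] by (simp add: pos_less_divide_eq add_nonneg_pos mult.commute)
      finally show "cmod (window_average (\<lambda>n. c * f n) N k - c * a) < e" .
    qed
  qed
qed

lemma has_uniform_mean_sum:
  assumes "finite I" "\<And>i. i \<in> I \<Longrightarrow> has_uniform_mean (f i) (a i)"
  shows "has_uniform_mean (\<lambda>n. \<Sum>i\<in>I. f i n) (\<Sum>i\<in>I. a i)"
  using assms
  by (induction I rule: finite_induct) (simp_all add: has_uniform_mean_const has_uniform_mean_add)

lemma has_uniform_mean_shift:
  assumes "has_uniform_mean f a"
  shows "has_uniform_mean (\<lambda>n. f (n + s)) a"
proof (rule has_uniform_meanI)
  fix e :: real assume "e > 0"
  from has_uniform_meanD[OF assms this]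
  show "\<forall>\<^sub>F N in sequentially. \<forall>k. cmod (window_average (\<lambda>n. f (n + s)) N k - a) < e"
  proof eventually_elim
    case (elim N)
    have "window_average (\<lambda>n. f (n + s)) N k = window_average f N (k + s)" for k
      by (simp add: window_average_def algebra_simps)
    with elim show ?case by simp
  qed
qed

lemma has_uniform_mean_cnj:
  assumes "has_uniform_mean f a"
  shows "has_uniform_mean (\<lambda>n. cnj (f n)) (cnj a)"
proof (rule has_uniform_meanI)
  fix e :: real assume "e > 0"
  from has_uniform_meanD[OF assms this]
  show "\<forall>\<^sub>F N in sequentially. \<forall>k. cmod (window_average (\<lambda>n. cnj (f n)) N k - cnj a) < e"
  proof eventually_elim
    case (elim N)
    have "window_average (\<lambda>n. cnj (f n)) N k - cnj a = cnj (window_average f N k - a)" for k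
      by (simp add: window_average_def)
    with elim show ?case by (simp only: complex_mod_cnj) blast
  qed
qed

text \<open>A uniformly small change of \<open>f\<close> moves all window averages by a small amount, so the means of
  approximating functions form a Cauchy family whose limit is the mean of \<open>f\<close>.\<close>

lemma has_uniform_mean_uniform_closure:
  assumes "\<And>e. e > 0 \<Longrightarrow> \<exists>g c. has_uniform_mean g c \<and> (\<forall>n. cmod (f n - g n) \<le> e)"
  shows "\<exists>c. has_uniform_mean f c"
proof -
  have "\<exists>c. \<forall>\<^sub>F N in sequentially. \<forall>k. cmod (window_average f N k - c) < e" if "e > 0" for e
  proof -
    obtain g c where g: "has_uniform_mean g c" "\<And>n. cmod (f n - g n) \<le> e / 2"
      using assms[OF half_gt_zero[OF \<open>e > 0\<close>]] by blast
    from has_uniform_meanD[OF g(1), of "e/2"] \<open>e > 0\<close>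
    have "\<forall>\<^sub>F N in sequentially. \<forall>k. cmod (window_average g N k - c) < e / 2"
      by simp
    then have "\<forall>\<^sub>F N in sequentially. \<forall>k. cmod (window_average f N k - c) < e"
    proof eventually_elim
      case (elim N)
      show ?case
      proof
        fix k
        have "cmod (window_average f N k - window_average g N k) \<le> e / 2"
          using window_average_diff_le[OF g(2)] that by simp
        then show "cmod (window_average f N k - c) < e"
          using elim[rule_format, of k]
            norm_triangle_ineq[of "window_average f N k - window_average g N k" "window_average g N k - c"]
          by simp
      qed
    qed
    then show ?thesis ..
  qed
  then obtain C where C: "\<And>e. e > 0 \<Longrightarrow> \<forall>\<^sub>F N in sequentially. \<forall>k. cmod (window_average f N k - C e) < e"
    by metis
  have close: "cmod (C d - C e) < d + e" if de: "d > 0" "e > 0" for d e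
  proof -
    obtain N where N: "cmod (window_average f N 0 - C d) < d" "cmod (window_average f N 0 - C e) < e"
      using sequentially_bot eventually_happens'[OF _ eventually_conj[OF C[OF de(1)] C[OF de(2)]]] by auto
    show ?thesis
      using N norm_triangle_ineq4[of "window_average f N 0 - C e" "window_average f N 0 - C d"] by simp
  qed
  define D where "D = (\<lambda>i. C (1 / real (Suc i)))"
  have "Cauchy D"
  proof (rule metric_CauchyI)
    fix e :: real assume "e > 0"
    then obtain M where M: "1 / real (Suc M) < e / 2"
      using reals_Archimedean[of "e/2"] by (auto simp: inverse_eq_divide)
    have le: "1 / real (Suc m) \<le> 1 / real (Suc M)" if "m \<ge> M" for m
      using that by (intro divide_left_mono) auto
    show "\<exists>M. \<forall>m\<ge>M. \<forall>n\<ge>M. dist (D m) (D n) < e"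
    proof (intro exI[of _ M] allI impI)
      fix m n assume mn: "M \<le> m" "M \<le> n"
      have "cmod (D m - D n) < 1 / real (Suc m) + 1 / real (Suc n)"
        unfolding D_def by (rule close) auto
      then show "dist (D m) (D n) < e"
        using le[OF mn(1)] le[OF mn(2)] M by (simp add: dist_norm)
    qed
  qed
  then obtain c where c: "D \<longlonglongrightarrow> c"
    using Cauchy_convergent_iff convergent_def by blast
  have "has_uniform_mean f c"
  proof (rule has_uniform_meanI)
    fix e :: real assume e: "e > 0"
    have "\<forall>\<^sub>F i in sequentially. dist (D i) c < e / 2"
      using tendstoD[OF c, of "e/2"] e by simp
    moreover have "\<forall>\<^sub>F i in sequentially. 1 / real (Suc i) < e / 2"
      using order_tendstoD(2)[OF LIMSEQ_inverse_real_of_nat, of "e/2"] e by (simp add: inverse_eq_divide)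
    ultimately obtain i where i: "dist (D i) c < e / 2" "1 / real (Suc i) < e / 2"
      using eventually_happens'[OF _ eventually_conj] sequentially_bot by blast
    have "\<forall>\<^sub>F N in sequentially. \<forall>k. cmod (window_average f N k - D i) < 1 / real (Suc i)"
      unfolding D_def by (rule C) auto
    then show "\<forall>\<^sub>F N in sequentially. \<forall>k. cmod (window_average f N k - c) < e"
    proof eventually_elim
      case (elim N)
      show ?case
      proof
        fix k
        show "cmod (window_average f N k - c) < e"
          using elim[rule_format, of k] i norm_triangle_ineq[of "window_average f N k - D i" "D i - c"]
          by (simp add: dist_norm)
      qed
    qed
  qed
  then show ?thesis ..
qed

lemma has_uniform_mean_zero_if_bounded_sums:
  assumes "\<And>N k. cmod (\<Sum>j<N. f (k + int j)) \<le> B"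
  shows "has_uniform_mean f 0"
proof (rule has_uniform_meanI)
  fix e :: real assume "e > 0"
  have "(\<lambda>N. B / real N) \<longlonglongrightarrow> 0"
    by (rule lim_const_over_n)
  from order_tendstoD(2)[OF this \<open>e > 0\<close>]
  show "\<forall>\<^sub>F N in sequentially. \<forall>k. cmod (window_average f N k - 0) < e"
  proof eventually_elim
    case (elim N)
    show ?case
    proof
      fix k
      have "cmod (window_average f N k - 0) \<le> B / real N"
        using assms[of k N] by (simp add: window_average_def norm_divide divide_right_mono)
      with elim show "cmod (window_average f N k - 0) < e" by linarith
    qed
  qed
qed

text \<open>Shifting a window by \<open>Q\<close> only changes its two ends: sums over a window of length \<open>N\<close> are traded
  for sums of the fixed length \<open>Q\<close>.\<close>

lemma sum_window_shift:
  fixes f :: "int \<Rightarrow> complex"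
  shows "(\<Sum>j<N. f (k + int Q + int j)) - (\<Sum>j<N. f (k + int j))
    = (\<Sum>j<Q. f (k + int N + int j)) - (\<Sum>j<Q. f (k + int j))"
proof -
  have split: "(\<Sum>j<a + b. f (k + int j)) = (\<Sum>j<a. f (k + int j)) + (\<Sum>j<b. f (k + int a + int j))" for a b
    by (induction b) (simp_all add: algebra_simps)
  show ?thesis
    using split[of N Q] split[of Q N] by (simp add: add.commute algebra_simps)
qed

text \<open>Shifting a window by \<open>Q\<close> multiplies its sum by \<open>w\<close> and changes it by at most \<open>2 Q\<close>. Since
  \<open>w \<noteq> 1\<close>, all window sums are bounded by \<open>2 Q / |w - 1|\<close>. The case of interest is a linear
  phase times a periodic function.\<close>

lemma has_uniform_mean_zero_if_twisted_periodic:
  assumes tw: "\<And>n. f (n + int Q) = w * f n" and w: "w \<noteq> 1" and bd: "\<And>n. cmod (f n) \<le> 1"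
  shows "has_uniform_mean f 0"
proof (rule has_uniform_mean_zero_if_bounded_sums)
  fix N k
  have bdsum: "cmod (\<Sum>j<Q. f (l + int j)) \<le> real Q" for l
    using sum_norm_bound[of "{..<Q}" "\<lambda>j. f (l + int j)" 1] bd by simp
  have "f (k + int Q + int j) = w * f (k + int j)" for j
    using tw[of "k + int j"] by (simp add: algebra_simps)
  then have "(\<Sum>j<Q. f (k + int N + int j)) - (\<Sum>j<Q. f (k + int j)) = (w - 1) * (\<Sum>j<N. f (k + int j))"
    using sum_window_shift[where f=f and k=k and Q=Q and N=N]
    by (simp add: sum_distrib_left[symmetric] left_diff_distrib)
  then have "cmod (w - 1) * cmod (\<Sum>j<N. f (k + int j))
      = cmod ((\<Sum>j<Q. f (k + int N + int j)) - (\<Sum>j<Q. f (k + int j)))"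
    by (metis norm_mult)
  also have "\<dots> \<le> real Q + real Q"
    by (rule order_trans[OF norm_triangle_ineq4 add_mono[OF bdsum bdsum]])
  finally show "cmod (\<Sum>j<N. f (k + int j)) \<le> 2 * real Q / cmod (w - 1)"
    using w by (simp add: pos_le_divide_eq mult.commute)
qed

text \<open>After subtracting the average over one period, window sums depend only on the length modulo the
  period and are therefore bounded.\<close>

lemma has_uniform_mean_periodic:
  assumes per: "\<And>n. f (n + int Q) = f n" and Q: "Q > 0"
  shows "\<exists>c. has_uniform_mean f c"
proof -
  define c where "c = (\<Sum>j<Q. f (int j)) / of_nat Q"
  \<comment> \<open>The part of mean zero.\<close>
  define g where "g n = f n - c" for n
  have gper: "g (n + int Q) = g n" for n
    by (simp add: g_def per)
  have step: "(\<Sum>j<Q. g (k + 1 + int j)) = (\<Sum>j<Q. g (k + int j))" for k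
    using sum_window_shift[of g k Q 1] gper[of k] by (simp add: algebra_simps)
  have zero: "(\<Sum>j<Q. g (k + int j)) = 0" for k
  proof (induction k rule: int_induct[of _ 0])
    case base
    show ?case using Q by (simp add: g_def c_def sum_subtractf)
  next
    case (step1 i)
    then show ?case using step[of i] by simp
  next
    case (step2 i)
    then show ?case using step[of "i - 1"] by simp
  qed
  have red: "(\<Sum>j<N. g (k + int j)) = (\<Sum>j<N mod Q. g (k + int j))" for N k
  proof (induction N rule: less_induct)
    case (less N)
    show ?case
    proof (cases "N < Q")
      case False
      then obtain M where M: "N = M + Q" by (metis add.commute le_iff_add not_less)
      have "(\<Sum>j<M + R. g (k + int j)) = (\<Sum>j<M. g (k + int j)) + (\<Sum>j<R. g (k + int M + int j))" for R
        by (induction R) (simp_all add: algebra_simps)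
      then have "(\<Sum>j<N. g (k + int j)) = (\<Sum>j<M. g (k + int j))"
        using zero[of "k + int M"] by (simp add: M)
      also have "\<dots> = (\<Sum>j<M mod Q. g (k + int j))"
        using Q by (intro less) (simp add: M)
      finally show ?thesis by (simp add: M)
    qed simp
  qed
  obtain B where B: "\<And>n. cmod (g n) \<le> B"
  proof -
    define B where "B = Max ((\<lambda>n. cmod (g n)) ` {0..<int Q})"
    have "cmod (g n) \<le> B" for n
    proof -
      have nat: "g (n + int m * int Q) = g n" for m n
      proof (induction m)
        case (Suc m)
        have "g (n + int (Suc m) * int Q) = g ((n + int m * int Q) + int Q)"
          by (simp add: algebra_simps)
        then show ?case
          using Suc by (simp only: gper)
      qed simp
      have "g n = g (n mod int Q)"
      proof (cases "n div int Q \<ge> 0")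
        case True
        then show ?thesis
          using nat[of "n mod int Q" "nat (n div int Q)"] by simp
      next
        case False
        have "n + int (nat (- (n div int Q))) * int Q = n mod int Q"
          using False by (simp add: minus_div_mult_eq_mod)
        then show ?thesis using nat[of n "nat (- (n div int Q))"] by simp
      qed
      moreover have "n mod int Q \<in> {0..<int Q}" using Q by simp
      ultimately show ?thesis unfolding B_def by (intro Max_ge) auto
    qed
    then show ?thesis by (rule that)
  qed
  then have "B \<ge> 0" using norm_ge_zero[of "g 0"] order_trans by blast
  have "cmod (\<Sum>j<N. g (k + int j)) \<le> real Q * B" for N k
  proof -
    have "cmod (\<Sum>j<N mod Q. g (k + int j)) \<le> real (N mod Q) * B"
      using sum_norm_bound[of "{..<N mod Q}" "\<lambda>j. g (k + int j)" B] B by simp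
    also have "\<dots> \<le> real Q * B"
      using Q \<open>B \<ge> 0\<close> by (intro mult_right_mono) (simp_all add: less_imp_le)
    finally show ?thesis by (subst red)
  qed
  then have "has_uniform_mean g 0" by (rule has_uniform_mean_zero_if_bounded_sums)
  from has_uniform_mean_add[OF this has_uniform_mean_const[of c]]
  show ?thesis by (auto simp: g_def)
qed

text \<open>Replace \<open>u\<close> by its local average \<open>v\<close> over \<open>H\<close> consecutive places, which changes window averages
  only by boundary terms of size \<open>2 H / N\<close>. By Cauchy--Schwarz the average of \<open>v\<close> is bounded by the
  root of the average of \<open>|v|\<^sup>2\<close>, and expanding the square leaves only the diagonal, of size
  \<open>1 / H\<close>, because the correlations have mean zero.\<close>

lemma has_uniform_mean_van_der_Corput:
  assumes unit: "\<And>n. cmod (u n) = 1"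
    and corr: "\<And>h::nat. h > 0 \<Longrightarrow> has_uniform_mean (\<lambda>n. u (n + int h) * cnj (u n)) 0"
  shows "has_uniform_mean u 0"
proof (rule has_uniform_meanI)
  fix e :: real assume e: "e > 0"
  \<comment> \<open>Twice the diagonal contribution \<open>1 / H\<close> must stay below \<open>(e / 2)\<^sup>2\<close>.\<close>
  obtain H :: nat where H: "H > 0" "2 / real H < (e / 2)\<^sup>2"
  proof -
    obtain H where "inverse (real (Suc H)) < (e / 2)\<^sup>2 / 2"
      using reals_Archimedean[of "(e/2)\<^sup>2 / 2"] e by auto
    then have "2 / real (Suc H) < (e / 2)\<^sup>2"
      by (simp add: inverse_eq_divide)
    then show ?thesis by (intro that[of "Suc H"]) auto
  qed
  define v where "v n = (\<Sum>h<H. u (n + int h)) / of_nat H" for n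
  have corr': "has_uniform_mean (\<lambda>n. u (n + int a) * cnj (u (n + int b))) (if a = b then 1 else 0)" for a b
  proof -
    consider "a = b" | "a > b" | "a < b" by linarith
    then show ?thesis
    proof cases
      case 1
      have "u n * cnj (u n) = 1" for n
        by (simp add: complex_norm_square[symmetric] unit)
      then show ?thesis using 1 by (simp add: has_uniform_mean_const)
    next
      case 2
      from has_uniform_mean_shift[OF corr[of "a - b"], of "int b"] 2
      show ?thesis by (simp add: algebra_simps of_nat_diff)
    next
      case 3
      from has_uniform_mean_cnj[OF has_uniform_mean_shift[OF corr[of "b - a"], of "int a"]] 3
      show ?thesis by (simp add: algebra_simps of_nat_diff)
    qed
  qed
  have "has_uniform_mean (\<lambda>n. 1 / (of_nat H)\<^sup>2 * (\<Sum>a<H. \<Sum>b<H. u (n + int a) * cnj (u (n + int b))))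
      (1 / (of_nat H)\<^sup>2 * (\<Sum>a<H. \<Sum>b<H. if a = b then 1 else 0))"
    by (intro has_uniform_mean_cmult has_uniform_mean_sum corr') auto
  moreover have "1 / (of_nat H)\<^sup>2 * (\<Sum>a<H. \<Sum>b<H. u (n + int a) * cnj (u (n + int b)))
      = of_real ((cmod (v n))\<^sup>2)" for n
    unfolding complex_norm_square v_def
    by (simp add: sum_product power2_eq_square)
  moreover have "1 / (of_nat H)\<^sup>2 * (\<Sum>a<H. \<Sum>b<H. if a = b then 1 else 0) = (1 / of_nat H :: complex)"
    using H(1) by (simp add: power2_eq_square)
  ultimately have "has_uniform_mean (\<lambda>n. of_real ((cmod (v n))\<^sup>2)) (1 / of_nat H)"
    by simp
  from has_uniform_meanD[OF this, of "1 / real H"] H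
  have ev1: "\<forall>\<^sub>F N in sequentially. \<forall>k. cmod (window_average (\<lambda>n. of_real ((cmod (v n))\<^sup>2)) N k - 1 / of_nat H) < 1 / real H"
    by simp
  have "(\<lambda>N. 2 * real H / real N) \<longlonglongrightarrow> 0"
    by (rule lim_const_over_n)
  from order_tendstoD(2)[OF this, of "e/2"] e
  have ev2: "\<forall>\<^sub>F N in sequentially. 2 * real H / real N < e / 2"
    by simp
  show "\<forall>\<^sub>F N in sequentially. \<forall>k. cmod (window_average u N k - 0) < e"
    using ev1 ev2 eventually_gt_at_top[of 0]
  proof eventually_elim
    case (elim N)
    then have N: "N > 0" by simp
    show ?case
    proof
      fix k
      have avg_v: "cmod (window_average v N k) < e / 2"
      proof -
        have "(cmod (\<Sum>j<N. v (k + int j)))\<^sup>2 \<le> (\<Sum>j<N. cmod (v (k + int j)))\<^sup>2"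
          by (intro power_mono norm_sum norm_ge_zero)
        also have "\<dots> \<le> real N * (\<Sum>j<N. (cmod (v (k + int j)))\<^sup>2)"
          using sum_squared_le_sum_of_squares[where I="{..<N}" and f="\<lambda>j. cmod (v (k + int j))"]
          by (simp add: mult.commute)
        finally have "(cmod (window_average v N k))\<^sup>2 \<le> (\<Sum>j<N. (cmod (v (k + int j)))\<^sup>2) / real N"
          using N by (simp add: window_average_def norm_divide power_divide power2_eq_square field_simps)
        also have "\<dots> = cmod (window_average (\<lambda>n. of_real ((cmod (v n))\<^sup>2)) N k)"
        proof -
          have "window_average (\<lambda>n. of_real ((cmod (v n))\<^sup>2)) N k
              = complex_of_real ((\<Sum>j<N. (cmod (v (k + int j)))\<^sup>2) / real N)"
            by (simp add: window_average_def)
          then show ?thesis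
            by (simp only: norm_of_real) (simp add: sum_nonneg)
        qed
        also have "\<dots> < 2 / real H"
          using elim(1)[rule_format, of k] norm_triangle_ineq2[of "window_average (\<lambda>n. of_real ((cmod (v n))\<^sup>2)) N k" "1 / of_nat H"]
          by (simp add: norm_divide)
        also have "\<dots> < (e/2)\<^sup>2" by (rule H(2))
        finally show ?thesis
          using power_less_imp_less_base[of _ 2 "e/2"] e by simp
      qed
      have diff: "cmod ((\<Sum>j<N. u (k + int h + int j)) - (\<Sum>j<N. u (k + int j))) \<le> 2 * real H" if "h < H" for h
      proof -
        have b: "cmod (\<Sum>j<h. u (l + int j)) \<le> real h" for l
          using sum_norm_bound[of "{..<h}" "\<lambda>j. u (l + int j)" 1] unit by simp
        have "cmod ((\<Sum>j<h. u (k + int N + int j)) - (\<Sum>j<h. u (k + int j))) \<le> real h + real h"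
          by (rule order_trans[OF norm_triangle_ineq4 add_mono[OF b b]])
        then show ?thesis using that by (simp add: sum_window_shift)
      qed
      have "(\<Sum>j<N. v (k + int j)) = (\<Sum>h<H. \<Sum>j<N. u (k + int h + int j)) / of_nat H"
        unfolding v_def sum_divide_distrib[symmetric]
        by (subst sum.swap) (simp add: algebra_simps)
      then have eq: "(\<Sum>j<N. v (k + int j)) - (\<Sum>j<N. u (k + int j))
          = (\<Sum>h<H. (\<Sum>j<N. u (k + int h + int j)) - (\<Sum>j<N. u (k + int j))) / of_nat H"
        using H(1) by (simp add: sum_subtractf diff_divide_distrib)
      have "cmod (\<Sum>h<H. (\<Sum>j<N. u (k + int h + int j)) - (\<Sum>j<N. u (k + int j))) \<le> real H * (2 * real H)"
        using sum_norm_bound[of "{..<H}" "\<lambda>h. (\<Sum>j<N. u (k + int h + int j)) - (\<Sum>j<N. u (k + int j))" "2 * real H"]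
          diff by simp
      then have "cmod ((\<Sum>j<N. v (k + int j)) - (\<Sum>j<N. u (k + int j))) \<le> 2 * real H"
        unfolding eq using H(1) by (simp add: norm_divide field_simps)
      then have "cmod (window_average v N k - window_average u N k) \<le> 2 * real H / real N"
        by (simp add: window_average_def diff_divide_distrib[symmetric] norm_divide divide_right_mono)
      then show "cmod (window_average u N k - 0) < e"
        using avg_v elim(2) norm_triangle_ineq4[of "window_average v N k" "window_average v N k - window_average u N k"]
        by simp
    qed
  qed
qed

section \<open>Equidistribution of polynomial phases\<close>

definition phase :: "real poly \<Rightarrow> int \<Rightarrow> complex" where
  "phase p n = cis (2 * pi * poly p (of_int n))"

definition shift_poly :: "int \<Rightarrow> real poly \<Rightarrow> real poly" where
  "shift_poly k p = pcompose p [:of_int k, 1:]"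

lemma phase_0 [simp]: "phase 0 n = 1"
  by (simp add: phase_def)

lemma norm_phase [simp]: "cmod (phase p n) = 1"
  by (simp add: phase_def)

lemma phase_add: "phase (p + q) n = phase p n * phase q n"
  by (simp add: phase_def cis_mult algebra_simps)

lemma phase_uminus: "phase (- p) n = cnj (phase p n)"
  by (simp add: phase_def cis_cnj)

lemma phase_shift_poly: "phase (shift_poly k p) n = phase p (n + k)"
  by (simp add: phase_def shift_poly_def poly_pcompose add.commute)

lemma cis_2pi_eq_1_iff: "cis (2 * pi * x) = 1 \<longleftrightarrow> x \<in> \<int>"
proof -
  have "cis (2 * pi * x) = 1 \<longleftrightarrow> exp (\<i> * of_real (2 * pi * x)) = 1"
    by (simp add: cis_conv_exp)
  also have "\<dots> \<longleftrightarrow> (\<exists>n::int. 2 * pi * x = of_int (2 * n) * pi)"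
    by (simp add: exp_eq_1)
  also have "\<dots> \<longleftrightarrow> x \<in> \<int>"
    by (auto simp: Ints_def)
  finally show ?thesis .
qed

text \<open>Only coefficients of index at least \<open>i\<close> contribute, and the one of index \<open>i\<close> contributes
  itself. Hence a difference \<open>shift_poly h p - p\<close> moves irrationality down by one index.\<close>

lemma coeff_shift_poly:
  "coeff (shift_poly h p) i = (\<Sum>l\<le>degree p. coeff p l * (of_nat (l choose i) * of_int h ^ (l - i)))"
proof -
  have "shift_poly h p = (\<Sum>l\<le>degree p. smult (coeff p l) ([:of_int h, 1:] ^ l))"
    unfolding shift_poly_def
    by (rule iffD1[OF poly_eq_poly_eq_iff])
       (simp add: fun_eq_iff poly_pcompose poly_altdef[of p] poly_sum)
  moreover have "coeff ([:of_int h, 1:] ^ l) i = (of_nat (l choose i) * of_int h ^ (l - i) :: real)" for l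
  proof (cases "i \<le> l")
    case True
    then show ?thesis by (simp add: coeff_linear_poly_power)
  next
    case False
    have "degree ([:of_int h :: real, 1:] ^ l) \<le> l"
      using degree_power_le[of "[:of_int h :: real, 1:]" l] by simp
    with False show ?thesis by (simp add: coeff_eq_0 binomial_eq_0)
  qed
  ultimately show ?thesis by (simp add: coeff_sum)
qed

text \<open>If \<open>D\<close> is a common denominator of the nonconstant coefficients, then \<open>D\<close> divides
  \<open>(n + D) ^ i - n ^ i\<close>, so that \<open>p(n + D) - p(n)\<close> is an integer.\<close>

lemma phase_periodic_if_rational:
  assumes rat: "\<And>i. i \<ge> 1 \<Longrightarrow> coeff p i \<in> \<rat>"
  obtains Q :: nat where "Q > 0" "\<And>n. phase p (n + int Q) = phase p n"
proof -
  have "\<exists>d::int. d > 0 \<and> of_int d * coeff p i \<in> \<int>" if i: "i \<ge> 1" for i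
  proof -
    obtain a b :: int where "b > 0" "coeff p i = of_int a / of_int b"
      using rat[OF i] by (metis Rats_cases')
    then show ?thesis by (intro exI[of _ b]) simp
  qed
  then obtain d :: "nat \<Rightarrow> int" where d: "\<And>i. i \<ge> 1 \<Longrightarrow> d i > 0 \<and> of_int (d i) * coeff p i \<in> \<int>"
    by metis
  define D where "D = (\<Prod>i\<in>{1..degree p}. d i)"
  have D: "D > 0"
    unfolding D_def using d by (intro prod_pos) auto
  have DZ: "of_int D * coeff p i \<in> \<int>" if "i \<in> {1..degree p}" for i
  proof -
    have "D = (\<Prod>j\<in>{1..degree p} - {i}. d j) * d i"
      using that by (simp add: D_def prod.remove[of _ i])
    then have "of_int D * coeff p i = of_int (\<Prod>j\<in>{1..degree p} - {i}. d j) * (of_int (d i) * coeff p i)"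
      by simp
    then show ?thesis using d[of i] that by (metis Ints_mult Ints_of_int atLeastAtMost_iff)
  qed
  have "phase p (n + D) = phase p n" for n
  proof -
    have "poly p (of_int (n + D)) - poly p (of_int n)
        = (\<Sum>i\<le>degree p. coeff p i * of_int ((n + D) ^ i - n ^ i))"
      by (simp add: poly_altdef sum_subtractf right_diff_distrib)
    also have "\<dots> \<in> \<int>"
    proof (rule Ints_sum)
      fix i assume i: "i \<in> {..degree p}"
      show "coeff p i * of_int ((n + D) ^ i - n ^ i) \<in> \<int>"
      proof (cases "i = 0")
        case False
        have "D dvd (n + D) ^ i - n ^ i"
          by (simp add: power_diff_sumr2)
        then obtain m where m: "(n + D) ^ i - n ^ i = D * m" by (elim dvdE)
        have "coeff p i * of_int ((n + D) ^ i - n ^ i) = (of_int D * coeff p i) * of_int m"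
          unfolding m by simp
        also have "\<dots> \<in> \<int>"
          using False i by (intro Ints_mult DZ) auto
        finally show ?thesis .
      qed simp
    qed
    finally have "cis (2 * pi * (poly p (of_int (n + D)) - poly p (of_int n))) = 1"
      by (simp only: cis_2pi_eq_1_iff)
    then have "phase p (n + D) / phase p n = 1"
      unfolding phase_def cis_divide by (simp add: algebra_simps)
    then show ?thesis by (simp add: phase_def)
  qed
  with D show ?thesis by (intro that[of "nat D"]) auto
qed

text \<open>Induction on the highest index \<open>j\<close> of an irrational coefficient. For \<open>j = 1\<close> the phase is an
  irrational linear phase times a periodic one. For larger indices the correlations in van der
  Corput's lemma are the phases of \<open>p(n + h) - p(n)\<close>, whose highest irrational coefficient has
  index one less.\<close>

lemma has_uniform_mean_phase_irrational:
  assumes "coeff p j \<notin> \<rat>" "j \<ge> 1" "\<And>i. i > j \<Longrightarrow> coeff p i \<in> \<rat>"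
  shows "has_uniform_mean (phase p) 0"
  using assms(2,1,3)
proof (induction j arbitrary: p rule: dec_induct)
  case base
  define a where "a = coeff p 1"
  define r where "r = p - monom a 1"
  have "coeff r i \<in> \<rat>" if "i \<ge> 1" for i
    using base(2)[of i] that by (cases "i = 1") (auto simp: r_def a_def)
  then obtain Q where Q: "Q > 0" "\<And>n. phase r (n + int Q) = phase r n"
    using phase_periodic_if_rational by blast
  have p: "phase p n = phase r n * phase (monom a 1) n" for n
    unfolding phase_add[symmetric] by (simp add: r_def)
  have lin: "phase (monom a 1) (n + int Q) = cis (2 * pi * (a * real Q)) * phase (monom a 1) n" for n
    by (simp add: phase_def poly_monom cis_mult algebra_simps)
  show ?case
  proof (rule has_uniform_mean_zero_if_twisted_periodic)
    show "phase p (n + int Q) = cis (2 * pi * (a * real Q)) * phase p n" for n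
      by (simp only: p Q(2) lin mult_ac)
    have "a * real Q \<notin> \<int>"
    proof
      assume "a * real Q \<in> \<int>"
      then have "a * real Q / real Q \<in> \<rat>" by (intro Rats_divide) (auto elim: Ints_cases)
      then show False using base(1) Q(1) by (simp add: a_def)
    qed
    then show "cis (2 * pi * (a * real Q)) \<noteq> 1"
      by (simp only: cis_2pi_eq_1_iff not_False_eq_True)
  qed simp
next
  case (step j)
  show ?case
  proof (rule has_uniform_mean_van_der_Corput)
    fix h :: nat assume h: "h > 0"
    define q where "q = shift_poly (int h) p - p"
    define t where "t i l = coeff p l * (real (l choose i) * real h ^ (l - i))" for i l
    have q: "coeff q i = (\<Sum>l\<in>{..degree p} - {i}. t i l)" for i
    proof (cases "i \<le> degree p")
      case True
      then have "coeff (shift_poly (int h) p) i = t i i + (\<Sum>l\<in>{..degree p} - {i}. t i l)"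
        unfolding coeff_shift_poly t_def
        by (subst sum.remove[of _ i]) auto
      then show ?thesis by (simp add: q_def t_def)
    next
      case False
      then show ?thesis
        by (simp add: q_def coeff_shift_poly t_def coeff_eq_0)
    qed
    have t_rat: "t i l \<in> \<rat>" if "l \<noteq> i" "l \<noteq> Suc j" "i \<ge> j" for i l
    proof (cases "l < i")
      case False
      with that have "coeff p l \<in> \<rat>" by (intro step) simp
      then show ?thesis by (simp add: t_def)
    qed (simp add: t_def binomial_eq_0)
    have le: "Suc j \<le> degree p"
      by (rule le_degree) (use step.prems(1) in auto)
    have "has_uniform_mean (phase q) 0"
    proof (rule step.IH)
      have "coeff q j = t j (Suc j) + (\<Sum>l\<in>{..degree p} - {j} - {Suc j}. t j l)"
        unfolding q using le by (subst sum.remove[of _ "Suc j"]) auto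
      moreover have "(\<Sum>l\<in>{..degree p} - {j} - {Suc j}. t j l) \<in> \<rat>"
        by (intro Rats_sum t_rat) auto
      moreover have "t j (Suc j) \<notin> \<rat>"
      proof
        have t: "t j (Suc j) = coeff p (Suc j) * (real (Suc j) * real h)"
          by (simp add: t_def)
        assume "t j (Suc j) \<in> \<rat>"
        then have "t j (Suc j) / (real (Suc j) * real h) \<in> \<rat>" by (intro Rats_divide) auto
        then show False using step.prems(1) h by (simp add: t del: of_nat_Suc)
      qed
      ultimately show "coeff q j \<notin> \<rat>"
        by (metis Rats_diff add_diff_cancel_right')
      show "coeff q i \<in> \<rat>" if "i > j" for i
        unfolding q
      proof (intro Rats_sum)
        fix l assume l: "l \<in> {..degree p} - {i}"
        show "t i l \<in> \<rat>"
        proof (cases "l = Suc j")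
          case True
          then show ?thesis using that l by (simp add: t_def binomial_eq_0)
        next
          case False
          then show ?thesis using that l by (intro t_rat) auto
        qed
      qed
    qed
    moreover have "phase q = (\<lambda>n. phase p (n + int h) * cnj (phase p n))"
      by (simp add: fun_eq_iff q_def diff_conv_add_uminus phase_add phase_uminus phase_shift_poly del: add_uminus_conv_diff)
    ultimately show "has_uniform_mean (\<lambda>n. phase p (n + int h) * cnj (phase p n)) 0"
      by simp
  qed simp
qed

text \<open>If some nonconstant coefficient is irrational, the previous lemma applies to the highest one;
  otherwise the phase is periodic.\<close>

lemma has_uniform_mean_phase: "\<exists>c. has_uniform_mean (phase p) c"
proof (cases "\<forall>i\<ge>1. coeff p i \<in> \<rat>")
  case True
  then obtain Q where "Q > 0" "\<And>n. phase p (n + int Q) = phase p n"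
    using phase_periodic_if_rational by blast
  then show ?thesis by (intro has_uniform_mean_periodic)
next
  case False
  define j where "j = Max {i. i \<ge> 1 \<and> coeff p i \<notin> \<rat>}"
  have fin: "finite {i. i \<ge> 1 \<and> coeff p i \<notin> \<rat>}"
  proof (rule finite_subset)
    show "{i. i \<ge> 1 \<and> coeff p i \<notin> \<rat>} \<subseteq> {..degree p}"
      by (auto intro: le_degree)
  qed simp
  have "j \<in> {i. i \<ge> 1 \<and> coeff p i \<notin> \<rat>}"
    unfolding j_def using False by (intro Max_in fin) auto
  moreover have "coeff p i \<in> \<rat>" if "i > j" for i
  proof (rule ccontr)
    assume "coeff p i \<notin> \<rat>"
    then have "i \<le> j" unfolding j_def using that by (intro Max_ge fin) auto
    with that show False by simp
  qed
  ultimately show ?thesis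
    using has_uniform_mean_phase_irrational[of p j] by blast
qed

section \<open>Pointwise convergence as a Hausdorff topology on functions\<close>

lemma continuous_on_coordinate: "continuous_on A (\<lambda>x. x i :: 'b::topological_space)"
  by (rule continuous_on_subset[OF continuous_on_product_coordinates]) simp

lemma open_coordinate_vimage:
  fixes W :: "'b::topological_space set"
  assumes "open W"
  shows "open {x. x i \<in> W}"
  using open_vimage[OF assms continuous_on_product_coordinates[of i]] by (simp only: vimage_def)

text \<open>Distinct points of a product are separated in one coordinate. Each of the three separation classes
  gets its own instance because the metric on functions with a countable domain already gives the
  weaker classes an arity, which has to be enlarged first.\<close>

instance "fun" :: (type, t0_space) t0_space
proof
  fix x y :: "'a \<Rightarrow> 'b" assume "x \<noteq> y"
  then obtain i where i: "x i \<noteq> y i" by auto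
  obtain U where U: "open U" "(x i \<in> U) \<noteq> (y i \<in> U)"
    using iffD1[OF separation_t0 i] by (elim exE conjE) simp
  have "open {z :: 'a \<Rightarrow> 'b. z i \<in> U}"
    by (rule open_coordinate_vimage[OF U(1)])
  moreover have "(x \<in> {z. z i \<in> U}) \<noteq> (y \<in> {z. z i \<in> U})"
    using U(2) by simp
  ultimately show "\<exists>U. open U \<and> \<not> (x \<in> U) = (y \<in> U)"
    by blast
qed

instance "fun" :: (type, t1_space) t1_space
proof
  fix x y :: "'a \<Rightarrow> 'b" assume "x \<noteq> y"
  then obtain i where i: "x i \<noteq> y i" by auto
  obtain U where U: "open U" "x i \<in> U" "y i \<notin> U"
    using t1_space[OF i] by blast
  have "open {z :: 'a \<Rightarrow> 'b. z i \<in> U}"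
    by (rule open_coordinate_vimage[OF U(1)])
  moreover have "x \<in> {z. z i \<in> U}" "y \<notin> {z. z i \<in> U}"
    using U(2,3) by simp_all
  ultimately show "\<exists>U. open U \<and> x \<in> U \<and> y \<notin> U"
    by blast
qed

instance "fun" :: (type, t2_space) t2_space
proof
  fix x y :: "'a \<Rightarrow> 'b" assume "x \<noteq> y"
  then obtain i where i: "x i \<noteq> y i" by auto
  obtain U V where UV: "open U" "open V" "x i \<in> U" "y i \<in> V" "U \<inter> V = {}"
    using hausdorff[OF i] by metis
  have "open {z :: 'a \<Rightarrow> 'b. z i \<in> U}" "open {z :: 'a \<Rightarrow> 'b. z i \<in> V}"
    by (rule open_coordinate_vimage[OF UV(1)], rule open_coordinate_vimage[OF UV(2)])
  moreover have "x \<in> {z. z i \<in> U}" "y \<in> {z. z i \<in> V}" "{z. z i \<in> U} \<inter> {z. z i \<in> V} = {}"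
    using UV(3-5) by auto
  ultimately show "\<exists>U V. open U \<and> open V \<and> x \<in> U \<and> y \<in> V \<and> U \<inter> V = {}"
    by blast
qed

lemma open_coordinate_ball:
  fixes x :: "'i \<Rightarrow> 'b::metric_space"
  assumes "finite I"
  shows "open {y. \<forall>i\<in>I. dist (y i) (x i) < e}"
proof -
  have "{y. \<forall>i\<in>I. dist (y i) (x i) < e} = (\<Inter>i\<in>I. {y. dist (y i) (x i) < e})"
    by auto
  then show ?thesis
    using assms by (auto intro!: open_INT open_Collect_less continuous_on_dist continuous_on_coordinate continuous_on_const)
qed

text \<open>The basic neighbourhoods of a point constrain finitely many coordinates.\<close>

lemma closure_fun_iff:
  fixes x :: "'i \<Rightarrow> 'b::metric_space"
  shows "x \<in> closure S \<longleftrightarrow> (\<forall>I e. finite I \<and> e > 0 \<longrightarrow> (\<exists>s\<in>S. \<forall>i\<in>I. dist (s i) (x i) < e))"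
proof (intro iffI allI impI)
  fix I :: "'i set" and e :: real
  assume x: "x \<in> closure S" and I: "finite I \<and> e > 0"
  have "open {y. \<forall>i\<in>I. dist (y i) (x i) < e}"
    using I by (intro open_coordinate_ball) simp
  moreover have "x \<in> {y. \<forall>i\<in>I. dist (y i) (x i) < e}"
    using I by simp
  ultimately show "\<exists>s\<in>S. \<forall>i\<in>I. dist (s i) (x i) < e"
    using x unfolding closure_iff_nhds_not_empty by fastforce
next
  assume *: "\<forall>I e. finite I \<and> e > 0 \<longrightarrow> (\<exists>s\<in>S. \<forall>i\<in>I. dist (s i) (x i) < e)"
  show "x \<in> closure S"
    unfolding closure_iff_nhds_not_empty
  proof (intro allI impI)
    fix A U assume U: "U \<subseteq> A" "open U" "x \<in> U"
    then obtain X where X: "x \<in> Pi\<^sub>E UNIV X" "\<And>i. open (X i)" "finite {i. X i \<noteq> UNIV}" "Pi\<^sub>E UNIV X \<subseteq> U"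
      using product_topology_open_contains_basis[of "\<lambda>_. euclidean" UNIV U x]
      unfolding open_fun_def by auto
    define I where "I = {i. X i \<noteq> UNIV}"
    have "\<exists>e>0. \<forall>y. dist y (x i) < e \<longrightarrow> y \<in> X i" for i
      using X(1,2) by (auto simp: open_dist PiE_iff)
    then obtain \<epsilon> where \<epsilon>: "\<And>i. \<epsilon> i > 0" "\<And>i y. dist y (x i) < \<epsilon> i \<Longrightarrow> y \<in> X i"
      by metis
    define e where "e = Min (insert 1 (\<epsilon> ` I))"
    have e: "e > 0" "\<And>i. i \<in> I \<Longrightarrow> e \<le> \<epsilon> i"
      using X(3) \<epsilon>(1) by (auto simp: e_def I_def)
    have "finite I" using X(3) by (simp add: I_def)
    with e(1) obtain s where s: "s \<in> S" "\<And>i. i \<in> I \<Longrightarrow> dist (s i) (x i) < e"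
      using * by blast
    have "s i \<in> X i" for i
    proof (cases "i \<in> I")
      case True
      then show ?thesis using s(2) e(2) by (intro \<epsilon>(2)) (meson less_le_trans)
    qed (simp add: I_def)
    then show "S \<inter> A \<noteq> {}"
      using s(1) X(4) U(1) by (blast intro: PiE_I)
  qed
qed

lemma compact_closure_fun:
  fixes S :: "('i \<Rightarrow> 'b::heine_borel) set"
  assumes "\<And>i. bounded ((\<lambda>s. s i) ` S)"
  shows "compact (closure S)"
proof -
  have "compactin (product_topology (\<lambda>_. euclidean) UNIV) (Pi\<^sub>E UNIV (\<lambda>i. closure ((\<lambda>s. s i) ` S)))"
    unfolding compactin_PiE using assms by (simp add: compact_closure)
  then have c: "compact (Pi\<^sub>E UNIV (\<lambda>i. closure ((\<lambda>s. s i) ` S)))"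
    by (simp add: euclidean_product_topology)
  have "closed (Pi\<^sub>E UNIV (\<lambda>i. closure ((\<lambda>s. s i) ` S)))"
    by (rule compact_imp_closed[OF c])
  then have "closure S \<subseteq> Pi\<^sub>E UNIV (\<lambda>i. closure ((\<lambda>s. s i) ` S))"
    by (rule closure_minimal[rotated]) (auto intro: subsetD[OF closure_subset])
  then show ?thesis
    using c compact_Int_closed[OF c closed_closure, of S] by (simp add: Int_absorb1)
qed

text \<open>On functions that are \<open>undefined\<close> off \<open>A\<close>, the coordinates outside \<open>A\<close> are constant and add no
  open sets. The Gelfand space thereby becomes a subset of a Hausdorff type, the setting of
  the type-class form of Stone--Weierstrass.\<close>

lemma subtopology_product_extensional:
  assumes "S \<subseteq> extensional A"
  shows "subtopology (product_topology (\<lambda>_. euclidean :: 'b::topological_space topology) A) S = top_of_set S"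
    (is "?P = ?E")
proof -
  have topP: "topspace ?P = S"
    using assms by (auto simp: PiE_def)
  have id1: "continuous_map ?P ?E id"
  proof -
    have "continuous_map ?P (product_topology (\<lambda>_. euclidean) UNIV) id"
      unfolding continuous_map_componentwise_UNIV
    proof
      fix k show "continuous_map ?P euclidean (\<lambda>x. id x k)"
      proof (cases "k \<in> A")
        case True
        then show ?thesis
          by (auto intro: continuous_map_from_subtopology continuous_map_product_projection)
      next
        case False
        have "continuous_map ?P euclidean (\<lambda>x. undefined)" by simp
        then show ?thesis
          by (rule continuous_map_eq) (use False assms topP in \<open>auto simp: extensional_def\<close>)
      qed
    qed
    then show ?thesis
      using topP by (simp add: euclidean_product_topology continuous_map_in_subtopology)
  qed
  have id2: "continuous_map ?E ?P id"
  proof -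
    have "continuous_map ?E (product_topology (\<lambda>_. euclidean) A) id"
      unfolding continuous_map_componentwise
    proof (intro conjI ballI)
      show "id ` topspace ?E \<subseteq> extensional A" using assms by simp
      fix k show "continuous_map ?E euclidean (\<lambda>x. id x k)"
        by (simp add: continuous_on_coordinate)
    qed
    then show ?thesis by (simp add: continuous_map_in_subtopology)
  qed
  show ?thesis
    unfolding topology_eq
  proof (intro allI iffI)
    fix U assume U: "openin ?P U"
    then have "openin ?E {x \<in> topspace ?E. id x \<in> U}"
      by (rule openin_continuous_map_preimage[OF id2])
    moreover have "{x \<in> topspace ?E. id x \<in> U} = U"
      using openin_subset[OF U] topP by auto
    ultimately show "openin ?E U" by simp
  next
    fix U assume U: "openin ?E U"
    then have "openin ?P {x \<in> topspace ?P. id x \<in> U}"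
      by (rule openin_continuous_map_preimage[OF id1])
    moreover have "{x \<in> topspace ?P. id x \<in> U} = U"
      using openin_subset[OF U] topP by auto
    ultimately show "openin ?P U" by simp
  qed
qed

section \<open>Uniform recurrence of polynomial phases\<close>

definition syndetic :: "int set \<Rightarrow> bool" where
  "syndetic R \<longleftrightarrow> (\<exists>L::nat. \<forall>k. \<exists>j<L. k + int j \<in> R)"

lemma syndetic_mono: "syndetic R \<Longrightarrow> R \<subseteq> R' \<Longrightarrow> syndetic R'"
  unfolding syndetic_def by (meson subsetD)

text \<open>The universal flow behind all polynomial phases: an integer \<open>n\<close> is identified with the character
  \<open>p \<mapsto> e(p(n))\<close> of the additive group of real polynomials, and shifting \<open>n\<close> amounts to translating
  the argument of \<open>p\<close>.\<close>

definition phase_point :: "int \<Rightarrow> real poly \<Rightarrow> complex" where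
  "phase_point n p = phase p n"

definition phase_shift :: "int \<Rightarrow> (real poly \<Rightarrow> complex) \<Rightarrow> real poly \<Rightarrow> complex" where
  "phase_shift k x p = x (shift_poly k p)"

definition phase_space :: "(real poly \<Rightarrow> complex) set" where
  "phase_space = closure (range phase_point)"

definition phase_orbit :: "(real poly \<Rightarrow> complex) \<Rightarrow> (real poly \<Rightarrow> complex) set" where
  "phase_orbit x = closure (range (\<lambda>k. phase_shift k x))"

lemma shift_poly_0 [simp]: "shift_poly 0 p = p"
  by (simp add: shift_poly_def pcompose_idR)

lemma shift_poly_shift_poly: "shift_poly k (shift_poly l p) = shift_poly (k + l) p"
  by (rule iffD1[OF poly_eq_poly_eq_iff]) (simp add: fun_eq_iff shift_poly_def poly_pcompose algebra_simps)

lemma phase_shift_phase_point: "phase_shift k (phase_point n) = phase_point (n + k)"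
  by (simp add: fun_eq_iff phase_shift_def phase_point_def phase_shift_poly)

lemma phase_shift_phase_shift: "phase_shift k (phase_shift l x) = phase_shift (k + l) x"
  by (simp add: fun_eq_iff phase_shift_def shift_poly_shift_poly add.commute)

lemma continuous_on_phase_shift: "continuous_on A (phase_shift k)"
  unfolding phase_shift_def
  by (intro continuous_on_coordinatewise_then_product continuous_on_coordinate)

lemma phase_space_add:
  assumes "x \<in> phase_space"
  shows "x (p + q) = x p * x q"
proof -
  have "closed {x :: real poly \<Rightarrow> complex. x (p + q) = x p * x q}"
    by (intro closed_Collect_eq continuous_intros continuous_on_coordinate)
  then have "phase_space \<subseteq> {x. x (p + q) = x p * x q}"
    unfolding phase_space_def by (rule closure_minimal[rotated]) (auto simp: phase_point_def phase_add)
  then show ?thesis using assms by auto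
qed

lemma phase_space_norm:
  assumes "x \<in> phase_space"
  shows "cmod (x p) = 1"
proof -
  have "closed {x :: real poly \<Rightarrow> complex. cmod (x p) = 1}"
    by (intro closed_Collect_eq continuous_intros continuous_on_coordinate)
  then have "phase_space \<subseteq> {x. cmod (x p) = 1}"
    unfolding phase_space_def by (rule closure_minimal[rotated]) (auto simp: phase_point_def)
  then show ?thesis using assms by auto
qed

lemma compact_phase_space: "compact phase_space"
  unfolding phase_space_def
proof (rule compact_closure_fun)
  fix p show "bounded ((\<lambda>s. s p) ` range phase_point)"
    by (auto simp: bounded_iff phase_point_def intro!: exI[of _ 1])
qed

lemma phase_shift_in_phase_orbit:
  assumes "z \<in> phase_orbit x"
  shows "phase_shift k z \<in> phase_orbit x"
proof -
  have "phase_shift k ` phase_orbit x \<subseteq> phase_orbit x"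
    unfolding phase_orbit_def
  proof (rule image_closure_subset[OF continuous_on_phase_shift closed_closure])
    show "phase_shift k ` range (\<lambda>k. phase_shift k x) \<subseteq> closure (range (\<lambda>k. phase_shift k x))"
      using closure_subset by (fastforce simp: phase_shift_phase_shift)
  qed
  with assms show ?thesis by auto
qed

lemma phase_shift_in_phase_space:
  assumes "x \<in> phase_space"
  shows "phase_shift k x \<in> phase_space"
proof -
  have "phase_shift k ` phase_space \<subseteq> phase_space"
    unfolding phase_space_def
  proof (rule image_closure_subset[OF continuous_on_phase_shift closed_closure])
    show "phase_shift k ` range phase_point \<subseteq> closure (range phase_point)"
      using closure_subset by (fastforce simp: phase_shift_phase_point)
  qed
  with assms show ?thesis by auto
qed

lemma phase_orbit_subset_phase_space:
  "x \<in> phase_space \<Longrightarrow> phase_orbit x \<subseteq> phase_space"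
  unfolding phase_orbit_def
  by (rule closure_minimal) (auto simp: phase_shift_in_phase_space, simp add: phase_space_def)

lemma degree_shift_poly_diff:
  assumes "degree p > 0"
  shows "degree (shift_poly k p - p) < degree p"
proof -
  have "coeff (shift_poly k p - p) i = 0" if "i \<ge> degree p" for i
  proof -
    have "coeff (shift_poly k p) i = (\<Sum>l\<le>degree p. if l = i then coeff p i else 0)"
      unfolding coeff_shift_poly
    proof (rule sum.cong)
      fix l assume "l \<in> {..degree p}"
      then have "l < i \<or> l = i" using that by auto
      then show "coeff p l * (of_nat (l choose i) * of_int k ^ (l - i)) = (if l = i then coeff p i else 0)"
        by (auto simp: binomial_eq_0)
    qed simp
    also have "\<dots> = coeff p i"
      using that by (auto simp: coeff_eq_0)
    finally show ?thesis by simp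
  qed
  then have "degree (shift_poly k p - p) \<le> degree p - 1"
    by (intro degree_le) (use assms in auto)
  with assms show ?thesis by simp
qed

lemma shift_poly_const: "degree p = 0 \<Longrightarrow> shift_poly k p = p"
  by (elim degree_eq_zeroE) (simp add: shift_poly_def)

lemma norm_cis_diff_1_le: "cmod (cis t - 1) \<le> \<bar>t\<bar>"
proof -
  have "cmod (cis t - 1) = 2 * \<bar>sin (t / 2)\<bar>"
    using dist_exp_i_1[of t] by (simp add: cis_conv_exp)
  also have "\<dots> \<le> \<bar>t\<bar>"
    using abs_sin_x_le_abs_x[of "t/2"] by simp
  finally show ?thesis .
qed

text \<open>In a compact group the powers of an element return to every neighbourhood of the identity. For a
  finite product of circles this is simultaneous Dirichlet approximation of the arguments.\<close>

lemma unit_powers_return: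
  fixes \<gamma> :: "'p \<Rightarrow> complex"
  assumes "finite P" "\<And>p. p \<in> P \<Longrightarrow> cmod (\<gamma> p) = 1" "e > 0"
  obtains j :: nat where "j > 0" "\<And>p. p \<in> P \<Longrightarrow> cmod (\<gamma> p ^ j - 1) < e"
proof -
  obtain f and n :: nat where f: "P = f ` {i. i < n}"
    using finite_imp_nat_seg_image_inj_on[OF assms(1)] by blast
  define \<theta> where "\<theta> i = Arg (\<gamma> (f i)) / (2 * pi)" for i
  have \<gamma>: "\<gamma> (f i) = cis (2 * pi * \<theta> i)" if "i < n" for i
    using assms(2)[of "f i"] that cis_Arg[of "\<gamma> (f i)"] by (cases "\<gamma> (f i) = 0") (auto simp: f \<theta>_def sgn_eq)
  obtain N :: nat where N: "N > 0" "2 * pi / real N < e"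
  proof -
    obtain N where "2 * pi / e < real N"
      using reals_Archimedean2 by blast
    moreover from this have "N > 0"
      using assms(3) by (cases N) (auto simp: divide_less_0_iff)
    ultimately show ?thesis
      using assms(3) by (intro that[of N]) (simp_all add: field_simps)
  qed
  obtain q m where qm: "0 < q" "\<And>i. i < n \<Longrightarrow> \<bar>of_int q * \<theta> i - of_int (m i)\<bar> < 1 / N"
    using Dirichlet_approx_simult[OF N(1), of n \<theta>] by metis
  have "cmod (\<gamma> p ^ nat q - 1) < e" if p: "p \<in> P" for p
  proof -
    obtain i where i: "i < n" "p = f i" using p f by blast
    have "\<gamma> p ^ nat q = cis (2 * pi * (of_int q * \<theta> i - of_int (m i)))"
    proof -
      have "cis (2 * pi * of_int (m i)) = 1"
        by (simp add: cis_2pi_eq_1_iff)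
      then show ?thesis
        using qm(1) by (simp add: i \<gamma> Complex.DeMoivre right_diff_distrib cis_divide[symmetric] algebra_simps)
    qed
    then have "cmod (\<gamma> p ^ nat q - 1) \<le> 2 * pi * \<bar>of_int q * \<theta> i - of_int (m i)\<bar>"
      using norm_cis_diff_1_le[of "2 * pi * (of_int q * \<theta> i - of_int (m i))"] by (simp add: abs_mult)
    also have "\<dots> \<le> 2 * pi * (1 / N)"
      using qm(2)[OF i(1)] by (intro mult_left_mono) auto
    also have "\<dots> < e" using N(2) by simp
    finally show ?thesis .
  qed
  with qm(1) show ?thesis by (intro that[of "nat q"]) auto
qed

text \<open>The inductive step is the group extension argument. Let \<open>y\<close> lie in the orbit closure of \<open>x\<close> and
  agree with the base point in degree below \<open>d\<close>. Then \<open>y = \<gamma> \<cdot> phase_point 0\<close>, where \<open>\<gamma>\<close> is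
  multiplicative in \<open>p\<close> and trivial in degree below \<open>d\<close>. As \<open>p(\<cdot> + k) - p\<close> has lower degree than
  \<open>p\<close>, and vanishes for constant \<open>p\<close>, multiplication by \<open>\<gamma>\<close> commutes with the shift in degree up to \<open>d\<close>. So the orbit closure of
  \<open>x\<close> contains, in these degrees, \<open>\<gamma>\<close> times every \<open>phase_point n\<close>, hence \<open>\<gamma>\<close> times every point of
  the whole space. Iterating, it contains \<open>\<gamma>\<^sup>j \<cdot> phase_point 0\<close> for all \<open>j > 0\<close>, and these
  accumulate at \<open>phase_point 0\<close>.\<close>

lemma phase_orbit_meets_fibre:
  assumes "x \<in> phase_space"
  shows "\<exists>y\<in>phase_orbit x. \<forall>p. degree p < d \<longrightarrow> y p = phase_point 0 p"
  using assms
proof (induction d)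
  case 0
  have "phase_shift 0 x \<in> phase_orbit x"
    unfolding phase_orbit_def using closure_subset by fastforce
  then show ?case by auto
next
  case (Suc d)
  then obtain y where y: "y \<in> phase_orbit x" "\<And>p. degree p < d \<Longrightarrow> y p = phase_point 0 p"
    by blast
  have yY: "y \<in> phase_space"
    using y(1) Suc.prems phase_orbit_subset_phase_space by blast
  define \<gamma> where "\<gamma> p = y p * cnj (phase_point 0 p)" for p
  have unit: "z * cnj z = 1" if "cmod z = 1" for z
    using that by (simp add: complex_norm_square[symmetric])
  have y_eq: "y p = \<gamma> p * phase_point 0 p" for p
    using unit[of "phase_point 0 p"] by (simp add: \<gamma>_def phase_point_def mult.assoc) (simp add: mult.commute)
  have \<gamma>_norm: "cmod (\<gamma> p) = 1" for p
    by (simp add: \<gamma>_def norm_mult phase_space_norm[OF yY] phase_point_def)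
  have \<gamma>_add: "\<gamma> (p + q) = \<gamma> p * \<gamma> q" for p q
    by (simp add: \<gamma>_def phase_space_add[OF yY] phase_point_def phase_add)
  have \<gamma>_low: "\<gamma> p = 1" if "degree p < d" for p
    using y(2)[OF that] unit[of "phase_point 0 p"] by (simp add: \<gamma>_def phase_point_def)
  have \<gamma>_shift: "\<gamma> (shift_poly k p) = \<gamma> p" if "degree p < Suc d" for k p
  proof (cases "degree p = 0")
    case False
    then have "\<gamma> (shift_poly k p - p) = 1"
      using degree_shift_poly_diff[of p k] that by (intro \<gamma>_low) simp
    then show ?thesis
      using \<gamma>_add[of "shift_poly k p - p" p] by simp
  qed (simp add: shift_poly_const)
  \<comment> \<open>Multiplication by a power of \<open>\<gamma>\<close>, with the coordinates of degree above \<open>d\<close> erased.\<close>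
  define cut :: "nat \<Rightarrow> (real poly \<Rightarrow> complex) \<Rightarrow> real poly \<Rightarrow> complex" where
    "cut j z p = (if degree p < Suc d then \<gamma> p ^ j * z p else 0)" for j z p
  have cont: "continuous_on A (cut j)" for A j
    unfolding cut_def
  proof (rule continuous_on_coordinatewise_then_product)
    fix p show "continuous_on A (\<lambda>z. if degree p < Suc d then \<gamma> p ^ j * z p else 0)"
      by (cases "degree p < Suc d")
         (auto intro!: continuous_intros continuous_on_coordinate)
  qed
  define K where "K = cut 0 ` phase_orbit x"
  have "closed (phase_orbit x)" by (simp add: phase_orbit_def)
  then have "compact (phase_orbit x)"
    using compact_Int_closed[OF compact_phase_space] phase_orbit_subset_phase_space[OF Suc.prems]
    by (metis Int_absorb1)
  then have clK: "closed K"
    unfolding K_def by (intro compact_imp_closed compact_continuous_image cont)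
  have shift_y: "cut j (phase_shift n y) = cut (Suc j) (phase_point n)" for j n
  proof
    fix p
    have "phase_shift n y p = \<gamma> p * phase_point n p" if "degree p < Suc d"
      using that by (simp add: phase_shift_def y_eq \<gamma>_shift) (simp add: phase_point_def phase_shift_poly)
    then show "cut j (phase_shift n y) p = cut (Suc j) (phase_point n) p"
      by (simp add: cut_def)
  qed
  have inK: "cut (Suc j) (phase_point n) \<in> K" for j n
  proof (induction j arbitrary: n)
    case 0
    show ?case
      unfolding shift_y[symmetric] K_def
      by (intro imageI phase_shift_in_phase_orbit y(1))
  next
    case (Suc j)
    have "cut (Suc j) ` phase_space \<subseteq> K"
      unfolding phase_space_def
      by (rule image_closure_subset[OF cont clK]) (use Suc in auto)
    then show ?case
      unfolding shift_y[symmetric] using phase_shift_in_phase_space[OF yY] by blast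
  qed
  have "cut 0 (phase_point 0) \<in> closure K"
    unfolding closure_fun_iff
  proof (intro allI impI)
    fix I :: "real poly set" and e :: real assume "finite I \<and> e > 0"
    then obtain j where j: "j > 0" "\<And>p. p \<in> I \<Longrightarrow> cmod (\<gamma> p ^ j - 1) < e"
      using unit_powers_return[of I \<gamma> e] \<gamma>_norm by blast
    have "dist (cut j (phase_point 0) p) (cut 0 (phase_point 0) p) < e" if "p \<in> I" for p
    proof -
      have "\<gamma> p ^ j * phase_point 0 p - phase_point 0 p = (\<gamma> p ^ j - 1) * phase_point 0 p"
        by (simp add: algebra_simps)
      then have "cmod (\<gamma> p ^ j * phase_point 0 p - phase_point 0 p) < e"
        using j(2)[OF that] by (simp add: norm_mult phase_point_def)
      then show ?thesis
        using \<open>finite I \<and> e > 0\<close> by (simp add: cut_def dist_norm)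
    qed
    moreover have "cut j (phase_point 0) \<in> K"
      using inK[of "j - 1" 0] j(1) by simp
    ultimately show "\<exists>s\<in>K. \<forall>i\<in>I. dist (s i) (cut 0 (phase_point 0) i) < e"
      by blast
  qed
  then obtain z where z: "z \<in> phase_orbit x" "cut 0 z = cut 0 (phase_point 0)"
    using clK by (auto simp: K_def)
  have "z p = phase_point 0 p" if "degree p < Suc d" for p
    using fun_cong[OF z(2), of p] that by (simp add: cut_def)
  with z(1) show ?case by blast
qed

text \<open>Every point of the compact space \<open>phase_space\<close> is moved into the given neighbourhood of
  \<open>phase_point m\<close> by some shift. By compactness finitely many shifts suffice for all points at
  once, and their range bounds the gaps between return times.\<close>

lemma phase_returns_syndetic:
  assumes P: "finite P" and e: "e > 0"
  shows "syndetic {n. \<forall>p\<in>P. cmod (phase p n - phase p m) < e}"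
proof -
  define U where "U n = {x :: real poly \<Rightarrow> complex. \<forall>p\<in>P. dist (phase_shift n x p) (phase_point m p) < e}" for n
  have openU: "open (U n)" for n
  proof -
    have "open (phase_shift n -` {y. \<forall>p\<in>P. dist (y p) (phase_point m p) < e})"
      by (intro open_vimage open_coordinate_ball P continuous_on_phase_shift)
    then show ?thesis by (simp add: U_def vimage_def)
  qed
  have cover: "\<exists>n. x \<in> U n" if x: "x \<in> phase_space" for x
  proof -
    \<comment> \<open>A bound for all degrees, so that agreement below \<open>d\<close> covers the coordinates in \<open>P\<close>.\<close>
    define d where "d = Suc (Max (insert 0 (degree ` shift_poly m ` P)))"
    have d: "degree (shift_poly m p) < d" if "p \<in> P" for p
      unfolding d_def less_Suc_eq_le using P that by (intro Max_ge) auto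
    obtain y where y: "y \<in> phase_orbit x" "\<And>p. degree p < d \<Longrightarrow> y p = phase_point 0 p"
      using phase_orbit_meets_fibre[OF x] by blast
    have ym: "phase_shift m y p = phase_point m p" if "p \<in> P" for p
      using y(2)[OF d[OF that]] by (simp add: phase_shift_def phase_point_def phase_shift_poly)
    have "phase_shift m y \<in> phase_orbit x"
      by (rule phase_shift_in_phase_orbit[OF y(1)])
    then obtain n where "\<forall>p\<in>P. dist (phase_shift n x p) (phase_shift m y p) < e"
      using P e unfolding phase_orbit_def closure_fun_iff by blast
    then show ?thesis
      using ym by (auto simp: U_def)
  qed
  then have "phase_space \<subseteq> (\<Union>n\<in>UNIV. U n)"
    by auto
  then obtain F where F: "finite F" "phase_space \<subseteq> (\<Union>n\<in>F. U n)"
    by (rule compactE_image[OF compact_phase_space openU])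
  define M where "M = (\<Sum>n\<in>F. nat \<bar>n\<bar>)"
  have M: "\<bar>n\<bar> \<le> int M" if "n \<in> F" for n
    using member_le_sum[of n F abs] F(1) that by (simp add: M_def)
  show ?thesis
    unfolding syndetic_def
  proof (rule exI[of _ "2 * M + 1"], rule allI)
    fix k
    have "phase_point (k + int M) \<in> phase_space"
      unfolding phase_space_def using closure_subset by fast
    then obtain n where n: "n \<in> F" "phase_point (k + int M) \<in> U n"
      using F(2) by blast
    define j where "j = nat (int M + n)"
    have j: "int j = int M + n" "j < 2 * M + 1"
      using M[OF n(1)] by (auto simp: j_def)
    from n(2) have "\<forall>p\<in>P. cmod (phase p (k + int j) - phase p m) < e"
      by (simp add: U_def phase_shift_phase_point j(1) add.assoc) (simp add: phase_point_def dist_norm)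
    with j(2) show "\<exists>j<2 * M + 1. k + int j \<in> {n. \<forall>p\<in>P. cmod (phase p n - phase p m) < e}"
      by blast
  qed
qed

section \<open>The Weyl algebra as the closure of trigonometric polynomials\<close>

lemma T_subalgebra_closed:
  assumes "T_subalgebra A"
  shows T_subalgebra_subset_linf: "A \<subseteq> linf"
    and T_subalgebra_const: "(\<lambda>_. c) \<in> A"
    and T_subalgebra_add: "f \<in> A \<Longrightarrow> g \<in> A \<Longrightarrow> (\<lambda>n. f n + g n) \<in> A"
    and T_subalgebra_mult: "f \<in> A \<Longrightarrow> g \<in> A \<Longrightarrow> (\<lambda>n. f n * g n) \<in> A"
    and T_subalgebra_cmult: "f \<in> A \<Longrightarrow> (\<lambda>n. c * f n) \<in> A"
    and T_subalgebra_cnj: "f \<in> A \<Longrightarrow> (\<lambda>n. cnj (f n)) \<in> A"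
    and T_subalgebra_shift: "f \<in> A \<Longrightarrow> (\<lambda>n. f (n + k)) \<in> A"
  using assms unfolding T_subalgebra_def by blast+

lemma T_subalgebra_uniform_limit:
  assumes "T_subalgebra A" "\<And>i::nat. F i \<in> A" "uniform_limit UNIV F f sequentially"
  shows "f \<in> A"
  using assms unfolding T_subalgebra_def by blast

lemma T_subalgebra_sum:
  assumes "T_subalgebra A" "finite I" "\<And>i. i \<in> I \<Longrightarrow> f i \<in> A"
  shows "(\<lambda>n. \<Sum>i\<in>I. f i n) \<in> A"
  using assms(2,3)
  by (induction I rule: finite_induct)
     (simp_all add: T_subalgebra_const[OF assms(1)] T_subalgebra_add[OF assms(1)])

lemma T_subalgebra_power:
  assumes "T_subalgebra A" "f \<in> A"
  shows "(\<lambda>n. f n ^ j) \<in> A"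
  by (induction j) (simp_all add: T_subalgebra_const[OF assms(1)] T_subalgebra_mult[OF assms(1)] assms(2))

inductive trig_poly :: "(int \<Rightarrow> complex) \<Rightarrow> bool" where
  monomial: "trig_poly (\<lambda>n. c * phase p n)"
| add: "trig_poly f \<Longrightarrow> trig_poly g \<Longrightarrow> trig_poly (\<lambda>n. f n + g n)"

lemma trig_poly_const: "trig_poly (\<lambda>_. c)"
  using trig_poly.monomial[of c 0] by simp

lemma trig_poly_monomial_mult:
  assumes "trig_poly g"
  shows "trig_poly (\<lambda>n. (c * phase p n) * g n)"
  using assms
proof induction
  case (monomial d q)
  show ?case
    using trig_poly.monomial[of "c * d" "p + q"] by (simp add: phase_add mult_ac)
next
  case (add f g)
  then show ?case
    using trig_poly.add by (simp only: distrib_left)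
qed

lemma trig_poly_mult:
  assumes "trig_poly f" "trig_poly g"
  shows "trig_poly (\<lambda>n. f n * g n)"
  using assms(1)
proof induction
  case (monomial c p)
  show ?case by (rule trig_poly_monomial_mult[OF assms(2)])
next
  case (add f h)
  then show ?case
    using trig_poly.add by (simp only: distrib_right)
qed

lemma trig_poly_cnj:
  assumes "trig_poly f"
  shows "trig_poly (\<lambda>n. cnj (f n))"
  using assms
proof induction
  case (monomial c p)
  show ?case
    using trig_poly.monomial[of "cnj c" "- p"] by (simp add: phase_uminus)
qed (simp add: trig_poly.add)

lemma trig_poly_shift:
  assumes "trig_poly f"
  shows "trig_poly (\<lambda>n. f (n + k))"
  using assms
proof induction
  case (monomial c p)
  show ?case
    using trig_poly.monomial[of c "shift_poly k p"] by (simp add: phase_shift_poly)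
qed (simp add: trig_poly.add)

lemma trig_poly_bounded:
  assumes "trig_poly f"
  shows "f \<in> linf"
  using assms
proof induction
  case (monomial c p)
  show ?case by (rule linfI[of _ "cmod c"]) (simp add: norm_mult)
next
  case (add f g)
  then show ?case
    by (simp add: T_subalgebra_add[OF T_subalgebra_linf])
qed

definition trig_limit :: "(int \<Rightarrow> complex) \<Rightarrow> bool" where
  "trig_limit f \<longleftrightarrow> (\<forall>e>0. \<exists>g. trig_poly g \<and> (\<forall>n. cmod (f n - g n) \<le> e))"

text \<open>Trigonometric polynomials form an algebra because phases multiply by adding their polynomials;
  boundedness makes products of approximations approximate the product.\<close>

lemma T_subalgebra_trig_limit: "T_subalgebra {f. trig_limit f}"
proof (rule T_subalgebraI)
  show "{f. trig_limit f} \<subseteq> linf"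
  proof
    fix f assume "f \<in> {f. trig_limit f}"
    then obtain g where g: "trig_poly g" "\<And>n. cmod (f n - g n) \<le> 1"
      unfolding trig_limit_def by (auto dest: spec[of _ 1])
    obtain C where "\<And>n. cmod (g n) \<le> C"
      using linfE[OF trig_poly_bounded[OF g(1)]] by blast
    then have "cmod (f n) \<le> C + 1" for n
      using g(2)[of n] norm_triangle_sub[of "f n" "g n"] by (meson add_mono order_trans)
    then show "f \<in> linf" by (rule linfI)
  qed
  show "(\<lambda>_. c) \<in> {f. trig_limit f}" for c
    using trig_poly_const by (auto simp: trig_limit_def intro!: exI[of _ "\<lambda>_. c"])
next
  fix f g assume fg: "f \<in> {f. trig_limit f}" "g \<in> {f. trig_limit f}"
  show "(\<lambda>n. f n + g n) \<in> {f. trig_limit f}"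
    unfolding mem_Collect_eq trig_limit_def
  proof (intro allI impI)
    fix e :: real assume "e > 0"
    then obtain f' g' where *: "trig_poly f'" "\<And>n. cmod (f n - f' n) \<le> e / 2"
        "trig_poly g'" "\<And>n. cmod (g n - g' n) \<le> e / 2"
      using fg unfolding mem_Collect_eq trig_limit_def by (metis half_gt_zero)
    have "cmod (f n + g n - (f' n + g' n)) \<le> e" for n
      using norm_triangle_ineq[of "f n - f' n" "g n - g' n"] *(2)[of n] *(4)[of n]
      by (simp add: algebra_simps)
    then show "\<exists>h. trig_poly h \<and> (\<forall>n. cmod (f n + g n - h n) \<le> e)"
      using trig_poly.add[OF *(1,3)] by blast
  qed
  show "(\<lambda>n. f n * g n) \<in> {f. trig_limit f}"
    unfolding mem_Collect_eq trig_limit_def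
  proof (intro allI impI)
    fix e :: real assume e: "e > 0"
    obtain g' where g': "trig_poly g'" "\<And>n. cmod (g n - g' n) \<le> 1"
      using fg(2) unfolding mem_Collect_eq trig_limit_def by (metis zero_less_one)
    obtain f0 where f0: "trig_poly f0" "\<And>n. cmod (f n - f0 n) \<le> 1"
      using fg(1) unfolding mem_Collect_eq trig_limit_def by (metis zero_less_one)
    obtain C where C: "\<And>n. cmod (f0 n) \<le> C"
      using linfE[OF trig_poly_bounded[OF f0(1)]] by blast
    have C0: "C \<ge> 0" using C[of 0] norm_ge_zero order_trans by blast
    have fC: "cmod (f n) \<le> C + 1" for n
      using f0(2)[of n] C[of n] norm_triangle_sub[of "f n" "f0 n"] by linarith
    define d where "d = min 1 (e / 2 / (C + 1))"
    have "d > 0" using C0 e by (simp add: d_def)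
    then obtain g1 where g1: "trig_poly g1" "\<And>n. cmod (g n - g1 n) \<le> d"
      using fg(2) unfolding mem_Collect_eq trig_limit_def by metis
    obtain D where D: "\<And>n. cmod (g1 n) \<le> D"
      using linfE[OF trig_poly_bounded[OF g1(1)]] by blast
    have D0: "D \<ge> 0" using D[of 0] norm_ge_zero order_trans by blast
    have "e / 2 / (D + 1) > 0" using D0 e by simp
    then obtain f1 where f1: "trig_poly f1" "\<And>n. cmod (f n - f1 n) \<le> e / 2 / (D + 1)"
      using fg(1) unfolding mem_Collect_eq trig_limit_def by metis
    have "cmod (f n * g n - f1 n * g1 n) \<le> e" for n
    proof -
      have "f n * g n - f1 n * g1 n = f n * (g n - g1 n) + (f n - f1 n) * g1 n"
        by (simp add: algebra_simps)
      then have "cmod (f n * g n - f1 n * g1 n) \<le> cmod (f n) * cmod (g n - g1 n) + cmod (f n - f1 n) * cmod (g1 n)"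
        by (metis norm_mult norm_triangle_ineq)
      also have "\<dots> \<le> (C + 1) * (e / 2 / (C + 1)) + (e / 2 / (D + 1)) * (D + 1)"
      proof (intro add_mono mult_mono fC f1(2))
        show "cmod (g n - g1 n) \<le> e / 2 / (C + 1)"
          using g1(2)[of n] by (simp add: d_def)
        show "cmod (g1 n) \<le> D + 1" using D[of n] by simp
      qed (use C0 D0 e in auto)
      also have "\<dots> = e"
      proof -
        have "c * (e / 2 / c) = e / 2" if "c > 0" for c :: real using that by simp
        from this[of "C + 1"] this[of "D + 1"] show ?thesis
          using C0 D0 by (simp only: mult.commute[of "e / 2 / (D + 1)"])
      qed
      finally show ?thesis .
    qed
    then show "\<exists>h. trig_poly h \<and> (\<forall>n. cmod (f n * g n - h n) \<le> e)"
      using trig_poly_mult[OF f1(1) g1(1)] by blast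
  qed
next
  fix f assume f: "f \<in> {f. trig_limit f}"
  show "(\<lambda>n. cnj (f n)) \<in> {f. trig_limit f}"
    unfolding mem_Collect_eq trig_limit_def
  proof (intro allI impI)
    fix e :: real assume "e > 0"
    then obtain g where g: "trig_poly g" "\<And>n. cmod (f n - g n) \<le> e"
      using f unfolding mem_Collect_eq trig_limit_def by blast
    show "\<exists>h. trig_poly h \<and> (\<forall>n. cmod (cnj (f n) - h n) \<le> e)"
      using trig_poly_cnj[OF g(1)] g(2)
      by (intro exI[of _ "\<lambda>n. cnj (g n)"]) (simp add: complex_cnj_diff[symmetric] del: complex_cnj_diff)
  qed
next
  fix f k assume f: "f \<in> {f. trig_limit f}"
  show "(\<lambda>n. f (n + k)) \<in> {f. trig_limit f}"
    unfolding mem_Collect_eq trig_limit_def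
  proof (intro allI impI)
    fix e :: real assume "e > 0"
    then obtain g where g: "trig_poly g" "\<And>n. cmod (f n - g n) \<le> e"
      using f unfolding mem_Collect_eq trig_limit_def by blast
    then show "\<exists>h. trig_poly h \<and> (\<forall>n. cmod (f (n + k) - h n) \<le> e)"
      using trig_poly_shift[OF g(1), of k] by blast
  qed
next
  fix F :: "nat \<Rightarrow> int \<Rightarrow> complex" and f
  assume F: "\<And>i. F i \<in> {f. trig_limit f}" and lim: "uniform_limit UNIV F f sequentially"
  show "f \<in> {f. trig_limit f}"
    unfolding mem_Collect_eq trig_limit_def
  proof (intro allI impI)
    fix e :: real assume "e > 0"
    then have "\<forall>\<^sub>F i in sequentially. \<forall>n\<in>UNIV. dist (F i n) (f n) < e / 2"
      by (intro uniform_limitD[OF lim]) simp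
    then obtain i where i: "\<And>n. dist (F i n) (f n) < e / 2"
      by (auto simp: eventually_sequentially)
    obtain g where g: "trig_poly g" "\<And>n. cmod (F i n - g n) \<le> e / 2"
      using F[of i] \<open>e > 0\<close> unfolding mem_Collect_eq trig_limit_def by (metis half_gt_zero)
    have "cmod (f n - g n) \<le> e" for n
      using norm_triangle_ineq[of "f n - F i n" "F i n - g n"] i[of n] g(2)[of n]
      by (simp add: dist_norm norm_minus_commute)
    then show "\<exists>h. trig_poly h \<and> (\<forall>n. cmod (f n - h n) \<le> e)"
      using g(1) by blast
  qed
qed

lemma weyl_algebra_trig_limit:
  assumes "f \<in> weyl_algebra"
  shows "trig_limit f"
proof -
  have "weyl_generators \<subseteq> {f. trig_limit f}"
  proof
    fix g assume "g \<in> weyl_generators"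
    then obtain k \<alpha> where g: "g = (\<lambda>n. exp (2 * of_real pi * \<i> * of_int (n ^ k) * of_real \<alpha>))"
      by (auto simp: weyl_generators_def)
    have "g = (\<lambda>n. 1 * phase (monom \<alpha> k) n)"
      unfolding g by (simp add: fun_eq_iff phase_def poly_monom cis_conv_exp mult_ac)
    then have "trig_poly g"
      by (simp only: trig_poly.monomial)
    then show "g \<in> {f. trig_limit f}"
      unfolding trig_limit_def by (auto intro!: exI[of _ g])
  qed
  from weyl_algebra_least[OF T_subalgebra_trig_limit this] assms show ?thesis by auto
qed

theorem weyl_has_uniform_mean:
  assumes "f \<in> weyl_algebra"
  shows "\<exists>c. has_uniform_mean f c"
proof (rule has_uniform_mean_uniform_closure)
  fix e :: real assume "e > 0"
  then obtain g where g: "trig_poly g" "\<And>n. cmod (f n - g n) \<le> e"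
    using weyl_algebra_trig_limit[OF assms] unfolding trig_limit_def by blast
  from g(1) have "\<exists>c. has_uniform_mean g c"
  proof induction
    case (monomial c p)
    then show ?case using has_uniform_mean_phase has_uniform_mean_cmult by blast
  next
    case (add f g)
    then show ?case using has_uniform_mean_add by blast
  qed
  with g(2) show "\<exists>g c. has_uniform_mean g c \<and> (\<forall>n. cmod (f n - g n) \<le> e)" by blast
qed

text \<open>A trigonometric polynomial is a uniformly continuous function of finitely many phases. This
  reduces returns of its values to simultaneous returns of phases.\<close>

lemma trig_poly_controlled_by_phases:
  assumes "trig_poly g" "e > 0"
  shows "\<exists>P d. finite P \<and> d > 0 \<and>
    (\<forall>n m. (\<forall>p\<in>P. cmod (phase p n - phase p m) < d) \<longrightarrow> cmod (g n - g m) < e)"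
  using assms
proof (induction arbitrary: e)
  case (monomial c p)
  show ?case
  proof (intro exI[of _ "{p}"] exI[of _ "e / (cmod c + 1)"] conjI allI impI)
    show "e / (cmod c + 1) > 0" using monomial by (simp add: add_nonneg_pos)
    fix n m assume "\<forall>q\<in>{p}. cmod (phase q n - phase q m) < e / (cmod c + 1)"
    then have "(cmod c + 1) * cmod (phase p n - phase p m) < e"
      by (simp add: pos_less_divide_eq add_nonneg_pos mult.commute)
    moreover have "cmod (c * phase p n - c * phase p m) = cmod c * cmod (phase p n - phase p m)"
      by (simp add: norm_mult right_diff_distrib[symmetric])
    moreover have "cmod c * cmod (phase p n - phase p m) \<le> (cmod c + 1) * cmod (phase p n - phase p m)"
      by (simp add: mult_right_mono)
    ultimately show "cmod (c * phase p n - c * phase p m) < e" by linarith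
  qed simp
next
  case (add f g)
  obtain P d where P: "finite P" "d > 0" "\<And>n m. (\<forall>p\<in>P. cmod (phase p n - phase p m) < d) \<Longrightarrow> cmod (f n - f m) < e / 2"
    using add.IH(1)[of "e/2"] add.prems by (auto simp del: less_divide_eq_numeral1)
  obtain Q d' where Q: "finite Q" "d' > 0" "\<And>n m. (\<forall>p\<in>Q. cmod (phase p n - phase p m) < d') \<Longrightarrow> cmod (g n - g m) < e / 2"
    using add.IH(2)[of "e/2"] add.prems by (auto simp del: less_divide_eq_numeral1)
  show ?case
  proof (intro exI[of _ "P \<union> Q"] exI[of _ "min d d'"] conjI allI impI)
    fix n m assume "\<forall>p\<in>P \<union> Q. cmod (phase p n - phase p m) < min d d'"
    then have "cmod (f n - f m) < e / 2" "cmod (g n - g m) < e / 2"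
      by (auto intro!: P(3) Q(3) simp del: less_divide_eq_numeral1)
    then show "cmod (f n + g n - (f m + g m)) < e"
      using norm_triangle_ineq[of "f n - f m" "g n - g m"] by (simp add: algebra_simps)
  qed (use P Q in auto)
qed

lemma weyl_controlled_by_phases:
  assumes "f \<in> weyl_algebra" "e > 0"
  shows "\<exists>P d. finite P \<and> d > 0 \<and>
    (\<forall>n m. (\<forall>p\<in>P. cmod (phase p n - phase p m) < d) \<longrightarrow> cmod (f n - f m) < e)"
proof -
  have e3: "e / 3 > 0" using assms(2) by simp
  obtain g where g: "trig_poly g" "\<And>n. cmod (f n - g n) \<le> e / 3"
    using weyl_algebra_trig_limit[OF assms(1)] e3 unfolding trig_limit_def by blast
  obtain P d where P: "finite P" "d > 0"
      "\<And>n m. \<forall>p\<in>P. cmod (phase p n - phase p m) < d \<Longrightarrow> cmod (g n - g m) < e / 3"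
    using trig_poly_controlled_by_phases[OF g(1) e3] by blast
  have "cmod (f n - f m) < e" if "\<forall>p\<in>P. cmod (phase p n - phase p m) < d" for n m
  proof -
    have "cmod (f n - f m) = cmod ((f n - g n) + (g n - g m) - (f m - g m))" by simp
    then have "cmod (f n - f m) \<le> cmod (f n - g n) + cmod (g n - g m) + cmod (f m - g m)"
      using norm_triangle_ineq4[of "(f n - g n) + (g n - g m)" "f m - g m"]
        norm_triangle_ineq[of "f n - g n" "g n - g m"] by linarith
    with P(3)[OF that] g(2)[of n] g(2)[of m] show ?thesis by linarith
  qed
  with P(1,2) show ?thesis by blast
qed

text \<open>All functions in \<open>F\<close> are controlled by one finite set of phases, whose returns are syndetic.\<close>

theorem weyl_returns_syndetic:
  assumes "finite F" "F \<subseteq> weyl_algebra" "e > 0"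
  shows "syndetic {n. \<forall>f\<in>F. cmod (f n - f m) < e}"
proof -
  have "\<exists>P d. finite P \<and> d > 0 \<and>
    (\<forall>n m. (\<forall>p\<in>P. cmod (phase p n - phase p m) < d) \<longrightarrow> (\<forall>f\<in>F. cmod (f n - f m) < e))"
    using assms(1,2)
  proof (induction F rule: finite_induct)
    case empty
    show ?case by (intro exI[of _ "{}"] exI[of _ 1]) simp
  next
    case (insert f F)
    obtain P d where P: "finite P" "d > 0"
        "\<And>n m. \<forall>p\<in>P. cmod (phase p n - phase p m) < d \<Longrightarrow> \<forall>f\<in>F. cmod (f n - f m) < e"
      using insert.IH insert.prems by auto
    obtain Q d' where Q: "finite Q" "d' > 0"
        "\<And>n m. \<forall>p\<in>Q. cmod (phase p n - phase p m) < d' \<Longrightarrow> cmod (f n - f m) < e"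
      using weyl_controlled_by_phases[of f e] insert.prems assms(3) by auto
    have "\<forall>h\<in>insert f F. cmod (h n - h m) < e"
      if "\<forall>p\<in>P \<union> Q. cmod (phase p n - phase p m) < min d d'" for n m
      using P(3)[of n m] Q(3)[of n m] that by simp
    then show ?case
      using P(1,2) Q(1,2) by (intro exI[of _ "P \<union> Q"] exI[of _ "min d d'"]) auto
  qed
  then obtain P d where P: "finite P" "d > 0"
      "\<And>n m. \<forall>p\<in>P. cmod (phase p n - phase p m) < d \<Longrightarrow> \<forall>f\<in>F. cmod (f n - f m) < e"
    by blast
  show ?thesis
    by (rule syndetic_mono[OF phase_returns_syndetic[OF P(1,2), of m]]) (use P(3) in auto)
qed

section \<open>Regular measures from positive functionals\<close>

lemma Urysohn_bump:
  assumes "compact_space X" "Hausdorff_space X" "closedin X S" "closedin X T" "S \<inter> T = {}"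
  obtains f where "continuous_map X euclideanreal f" "\<And>x. x \<in> topspace X \<Longrightarrow> 0 \<le> f x \<and> f x \<le> (1::real)"
    "\<And>x. x \<in> S \<Longrightarrow> f x = 1" "\<And>x. x \<in> T \<Longrightarrow> f x = 0"
proof -
  have "normal_space X"
    using assms by (intro compact_Hausdorff_or_regular_imp_normal_space) auto
  moreover have "disjnt T S" using assms(5) by (auto simp: disjnt_def)
  ultimately obtain f where f: "continuous_map X (top_of_set {0..1::real}) f" "f ` T \<subseteq> {0}" "f ` S \<subseteq> {1}"
    using Urysohn_lemma[of X T S 0 1] assms by auto
  then have "continuous_map X euclideanreal f" "\<And>x. x \<in> topspace X \<Longrightarrow> f x \<in> {0..1}"
    by (auto simp: continuous_map_in_subtopology)
  with f show ?thesis by (intro that[of f]) auto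
qed

text \<open>Functions are relevant only on the carrier of \<open>X\<close>; monotonicity, stated on the carrier, makes
  \<open>\<Lambda>\<close> insensitive to their values elsewhere.\<close>

locale normalized_functional =
  fixes X :: "'a topology" and \<Lambda> :: "('a \<Rightarrow> real) \<Rightarrow> real"
  assumes compact_X: "compact_space X" and Hausdorff_X: "Hausdorff_space X"
    and mono: "\<And>f g. continuous_map X euclideanreal f \<Longrightarrow> continuous_map X euclideanreal g \<Longrightarrow>
      (\<And>x. x \<in> topspace X \<Longrightarrow> f x \<le> g x) \<Longrightarrow> \<Lambda> f \<le> \<Lambda> g"
    and add: "\<And>f g. continuous_map X euclideanreal f \<Longrightarrow> continuous_map X euclideanreal g \<Longrightarrow>
      \<Lambda> (\<lambda>x. f x + g x) = \<Lambda> f + \<Lambda> g"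
    and const: "\<And>c. \<Lambda> (\<lambda>_. c) = c"
begin

definition bump :: "('a \<Rightarrow> real) \<Rightarrow> 'a set \<Rightarrow> bool" where
  "bump f U \<longleftrightarrow> continuous_map X euclideanreal f \<and> (\<forall>x\<in>topspace X. 0 \<le> f x \<and> f x \<le> 1) \<and>
     (\<forall>x\<in>topspace X - U. f x = 0)"

definition open_content :: "'a set \<Rightarrow> ennreal" where
  "open_content U = (SUP f\<in>{f. bump f U}. ennreal (\<Lambda> f))"

definition outer_content :: "'a set \<Rightarrow> ennreal" where
  "outer_content A = (INF U\<in>{U. openin X U \<and> A \<subseteq> U}. open_content U)"

lemma bump_mono: "bump f U \<Longrightarrow> U \<subseteq> V \<Longrightarrow> bump f V"
  by (auto simp: bump_def)

lemma bump_0: "bump (\<lambda>_. 0) U"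
  by (simp add: bump_def)

lemma \<Lambda>_nonneg: "bump f U \<Longrightarrow> 0 \<le> \<Lambda> f"
  using mono[of "\<lambda>_. 0" f] const[of 0] by (simp add: bump_def)

lemma \<Lambda>_le_open_content: "bump f U \<Longrightarrow> ennreal (\<Lambda> f) \<le> open_content U"
  unfolding open_content_def by (rule SUP_upper) simp

lemma open_content_le: "(\<And>f. bump f U \<Longrightarrow> ennreal (\<Lambda> f) \<le> c) \<Longrightarrow> open_content U \<le> c"
  unfolding open_content_def by (rule SUP_least) simp

lemma open_content_mono: "U \<subseteq> V \<Longrightarrow> open_content U \<le> open_content V"
  by (rule open_content_le) (blast intro: \<Lambda>_le_open_content bump_mono)

lemma open_content_le_1: "open_content U \<le> 1"
proof (rule open_content_le)
  fix f assume "bump f U"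
  then have "\<Lambda> f \<le> \<Lambda> (\<lambda>_. 1)"
    by (intro mono) (auto simp: bump_def)
  then show "ennreal (\<Lambda> f) \<le> 1" by (simp add: const)
qed

lemma open_content_topspace: "open_content (topspace X) = 1"
proof (rule antisym[OF open_content_le_1])
  have "bump (\<lambda>_. 1) (topspace X)" by (simp add: bump_def)
  from \<Lambda>_le_open_content[OF this] show "1 \<le> open_content (topspace X)"
    by (simp add: const)
qed

text \<open>Cutting \<open>f\<close> off at height \<open>e\<close> costs at most \<open>e\<close> and makes it vanish off a closed, hence compact,
  subset of \<open>U\<close>. All regularity and subadditivity arguments rest on this.\<close>

lemma bump_truncate:
  assumes "bump f U" "e > 0"
  defines "K \<equiv> {x \<in> topspace X. e \<le> f x}"
  defines "f' \<equiv> (\<lambda>x. max 0 (f x - e))"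
  shows "bump f' K" "K \<subseteq> U" "closedin X K" "\<Lambda> f \<le> \<Lambda> f' + e"
    "\<And>x. x \<in> topspace X \<Longrightarrow> f' x \<le> f x"
proof -
  have f: "continuous_map X euclideanreal f" "\<And>x. x \<in> topspace X \<Longrightarrow> 0 \<le> f x \<and> f x \<le> 1"
    using assms(1) by (auto simp: bump_def)
  have f': "continuous_map X euclideanreal f'"
    unfolding f'_def by (intro continuous_intros f(1))
  have "f x - e \<le> 1" if "x \<in> topspace X" for x
    using f(2)[OF that] assms(2) by simp
  then show "bump f' K"
    using f f' assms(2) by (auto simp: bump_def f'_def K_def)
  show "K \<subseteq> U"
    using assms(1,2) by (auto simp: bump_def K_def) (metis DiffI not_le)
  have "closedin X {x \<in> topspace X. f x \<in> {e..}}"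
    by (rule closedin_continuous_map_preimage[OF f(1)]) simp
  then show "closedin X K" by (simp add: K_def)
  have "\<Lambda> f \<le> \<Lambda> (\<lambda>x. f' x + e)"
    by (intro mono f(1) continuous_intros f') (auto simp: f'_def)
  also have "\<dots> = \<Lambda> f' + e"
    using add[OF f', of "\<lambda>_. e"] by (simp add: const)
  finally show "\<Lambda> f \<le> \<Lambda> f' + e" .
  show "f' x \<le> f x" if "x \<in> topspace X" for x
    using f(2)[OF that] assms(2) by (simp add: f'_def)
qed

text \<open>After truncation, \<open>h\<close> vanishes off a closed set \<open>K\<close> inside the union. A Urysohn function that is
  \<open>1\<close> on the part of \<open>K\<close> outside \<open>V\<close> and \<open>0\<close> outside \<open>U\<close> splits \<open>h\<close> into a part carried by \<open>U\<close>
  and a part carried by \<open>V\<close>.\<close>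

lemma open_content_Un:
  assumes "openin X U" "openin X V"
  shows "open_content (U \<union> V) \<le> open_content U + open_content V"
proof (rule open_content_le)
  fix h assume h: "bump h (U \<union> V)"
  show "ennreal (\<Lambda> h) \<le> open_content U + open_content V"
  proof (rule ennreal_le_epsilon)
    fix e :: real assume e: "e > 0"
    define K where "K = {x \<in> topspace X. e \<le> h x}"
    define h' where "h' = (\<lambda>x. max 0 (h x - e))"
    note t = bump_truncate[OF h e, folded K_def h'_def]
    have "closedin X (K - V)" "closedin X (topspace X - U)" "(K - V) \<inter> (topspace X - U) = {}"
      using t(2,3) assms by (auto intro: closedin_diff)
    then obtain \<phi> where \<phi>: "continuous_map X euclideanreal \<phi>"
        "\<And>x. x \<in> topspace X \<Longrightarrow> 0 \<le> \<phi> x \<and> \<phi> x \<le> 1"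
        "\<And>x. x \<in> K - V \<Longrightarrow> \<phi> x = 1" "\<And>x. x \<in> topspace X - U \<Longrightarrow> \<phi> x = 0"
      using Urysohn_bump[OF compact_X Hausdorff_X] by blast
    have h': "continuous_map X euclideanreal h'" "\<And>x. x \<in> topspace X \<Longrightarrow> 0 \<le> h' x \<and> h' x \<le> 1"
        "\<And>x. x \<in> topspace X - K \<Longrightarrow> h' x = 0"
      using t(1) by (auto simp: bump_def)
    have f: "bump (\<lambda>x. h' x * \<phi> x) U"
      unfolding bump_def using h' \<phi> by (auto intro!: continuous_intros mult_le_one)
    have g: "bump (\<lambda>x. h' x * (1 - \<phi> x)) V"
      unfolding bump_def
    proof (intro conjI ballI)
      fix x assume x: "x \<in> topspace X - V"
      show "h' x * (1 - \<phi> x) = 0"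
        using h'(3)[of x] \<phi>(3)[of x] x by (cases "x \<in> K") auto
    qed (use h' \<phi> in \<open>auto intro!: continuous_intros mult_le_one mult_nonneg_nonneg\<close>)
    have "\<Lambda> h' = \<Lambda> (\<lambda>x. h' x * \<phi> x + h' x * (1 - \<phi> x))"
      by (simp add: algebra_simps)
    also have "\<dots> = \<Lambda> (\<lambda>x. h' x * \<phi> x) + \<Lambda> (\<lambda>x. h' x * (1 - \<phi> x))"
      using f g by (intro add) (auto simp: bump_def)
    finally have "ennreal (\<Lambda> h) \<le> ennreal (\<Lambda> (\<lambda>x. h' x * \<phi> x) + \<Lambda> (\<lambda>x. h' x * (1 - \<phi> x)) + e)"
      using t(4) by (intro ennreal_leI) simp
    also have "\<dots> = ennreal (\<Lambda> (\<lambda>x. h' x * \<phi> x)) + ennreal (\<Lambda> (\<lambda>x. h' x * (1 - \<phi> x))) + ennreal e"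
      using \<Lambda>_nonneg[OF f] \<Lambda>_nonneg[OF g] e by simp
    also have "\<dots> \<le> open_content U + open_content V + ennreal e"
      by (intro add_mono \<Lambda>_le_open_content f g order_refl)
    finally show "ennreal (\<Lambda> h) \<le> open_content U + open_content V + ennreal e" .
  qed
qed

lemma open_content_empty: "open_content {} = 0"
proof -
  have "open_content {} \<le> 0"
  proof (rule open_content_le)
    fix f assume "bump f {}"
    then have "\<Lambda> f \<le> \<Lambda> (\<lambda>_. 0)"
      by (intro mono) (auto simp: bump_def)
    then show "ennreal (\<Lambda> f) \<le> 0" by (simp add: const ennreal_neg)
  qed
  then show ?thesis by simp
qed

lemma open_content_UN_lessThan:
  assumes "\<And>i::nat. openin X (U i)"
  shows "open_content (\<Union>i<n. U i) \<le> (\<Sum>i<n. open_content (U i))"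
proof (induction n)
  case (Suc n)
  have "(\<Union>i<Suc n. U i) = (\<Union>i<n. U i) \<union> U n"
    by (auto simp: less_Suc_eq)
  moreover have "openin X (\<Union>i<n. U i)"
    by (rule openin_Union) (use assms in auto)
  ultimately have "open_content (\<Union>i<Suc n. U i) \<le> open_content (\<Union>i<n. U i) + open_content (U n)"
    using open_content_Un[of "\<Union>i<n. U i" "U n"] assms by simp
  also have "\<dots> \<le> (\<Sum>i<n. open_content (U i)) + open_content (U n)"
    by (rule add_right_mono[OF Suc])
  finally show ?case by simp
qed (simp add: open_content_empty)

text \<open>By compactness a truncated function on the union lives on finitely many of the sets.\<close>

lemma open_content_UN:
  assumes U: "\<And>i::nat. openin X (U i)"
  shows "open_content (\<Union>i. U i) \<le> (\<Sum>i. open_content (U i))"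
proof (rule open_content_le)
  fix h assume h: "bump h (\<Union>i. U i)"
  show "ennreal (\<Lambda> h) \<le> (\<Sum>i. open_content (U i))"
  proof (rule ennreal_le_epsilon)
    fix e :: real assume e: "e > 0"
    define K where "K = {x \<in> topspace X. e \<le> h x}"
    define h' where "h' = (\<lambda>x. max 0 (h x - e))"
    note t = bump_truncate[OF h e, folded K_def h'_def]
    have "compactin X K"
      by (rule closedin_compact_space[OF compact_X t(3)])
    then obtain \<F> where \<F>: "finite \<F>" "\<F> \<subseteq> range U" "K \<subseteq> \<Union>\<F>"
      using compactinD[of X K "range U"] U t(2) by auto
    then obtain I where I: "finite I" "\<F> = U ` I"
      using finite_subset_image[of \<F> U UNIV] by auto
    then obtain n where "I \<subseteq> {..<n}"
      using finite_nat_iff_bounded by blast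
    then have "bump h' (\<Union>i<n. U i)"
      using \<F>(3) I(2) by (intro bump_mono[OF t(1)]) blast
    then have "ennreal (\<Lambda> h') \<le> (\<Sum>i<n. open_content (U i))"
      by (intro order_trans[OF \<Lambda>_le_open_content open_content_UN_lessThan[OF U]])
    also have "\<dots> \<le> (\<Sum>i. open_content (U i))"
      by (rule sum_le_suminf) auto
    finally have "ennreal (\<Lambda> h') + ennreal e \<le> (\<Sum>i. open_content (U i)) + ennreal e"
      by (rule add_right_mono)
    moreover have "ennreal (\<Lambda> h) \<le> ennreal (\<Lambda> h') + ennreal e"
      using t(4) \<Lambda>_nonneg[OF t(1)] e by (simp add: ennreal_plus[symmetric] ennreal_leI del: ennreal_plus)
    ultimately show "ennreal (\<Lambda> h) \<le> (\<Sum>i. open_content (U i)) + ennreal e"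
      by (rule order_trans[rotated])
  qed
qed

lemma outer_content_le: "openin X U \<Longrightarrow> A \<subseteq> U \<Longrightarrow> outer_content A \<le> open_content U"
  unfolding outer_content_def by (rule INF_lower) simp

lemma outer_content_open: "openin X U \<Longrightarrow> outer_content U = open_content U"
  unfolding outer_content_def by (rule INF_eqI) (auto intro: open_content_mono)

lemma outer_content_mono: "A \<subseteq> B \<Longrightarrow> outer_content A \<le> outer_content B"
  unfolding outer_content_def by (rule INF_superset_mono) auto

lemma outer_content_approx:
  assumes "A \<subseteq> topspace X" "e > 0"
  obtains U where "openin X U" "A \<subseteq> U" "open_content U \<le> outer_content A + ennreal e"
proof -
  have "outer_content A \<le> open_content (topspace X)"
    by (rule outer_content_le) (use assms in auto)
  then have "outer_content A < \<infinity>"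
    by (simp add: open_content_topspace less_top_ennreal[symmetric] order_le_less_trans[OF _ ennreal_one_less_top])
  then have "outer_content A < outer_content A + ennreal e"
    using assms(2) by (simp add: ennreal_add_left_cancel_less)
  then show ?thesis
    using that unfolding outer_content_def[of A] INF_less_iff by (auto intro: less_imp_le)
qed

lemma outer_measure_space_outer_content: "outer_measure_space (Pow (topspace X)) outer_content"
  unfolding outer_measure_space_def
proof (intro conjI)
  show "positive (Pow (topspace X)) outer_content"
    using outer_content_open[of "{}"] by (simp add: positive_def open_content_empty)
  show "increasing (Pow (topspace X)) outer_content"
    by (simp add: increasing_def outer_content_mono)
  show "countably_subadditive (Pow (topspace X)) outer_content"
    unfolding countably_subadditive_def
  proof (intro allI impI)
    fix A :: "nat \<Rightarrow> 'a set" assume A: "range A \<subseteq> Pow (topspace X)"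
    show "outer_content (\<Union>i. A i) \<le> (\<Sum>i. outer_content (A i))"
    proof (rule ennreal_le_epsilon)
      fix e :: real assume e: "e > 0"
      have "\<exists>U. openin X U \<and> A i \<subseteq> U \<and> open_content U \<le> outer_content (A i) + ennreal (e * (1/2) ^ Suc i)" for i
        by (rule outer_content_approx[of "A i" "e * (1/2) ^ Suc i"]) (use A e in auto)
      then obtain U where U: "\<And>i. openin X (U i)" "\<And>i. A i \<subseteq> U i"
          "\<And>i. open_content (U i) \<le> outer_content (A i) + ennreal (e * (1/2) ^ Suc i)"
        by metis
      have "outer_content (\<Union>i. A i) \<le> open_content (\<Union>i. U i)"
        using U(1,2) by (intro outer_content_le) auto
      also have "\<dots> \<le> (\<Sum>i. open_content (U i))"
        by (rule open_content_UN[OF U(1)])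
      also have "\<dots> \<le> (\<Sum>i. outer_content (A i) + ennreal (e * (1/2) ^ Suc i))"
        by (intro suminf_le U(3)) auto
      also have "\<dots> = (\<Sum>i. outer_content (A i)) + (\<Sum>i. ennreal (e * (1/2) ^ Suc i))"
        by (intro suminf_add[symmetric]) auto
      also have "(\<Sum>i. ennreal (e * (1/2) ^ Suc i)) = ennreal e"
        using sums_mult[OF power_half_series, of e] e by (intro suminf_ennreal_eq) auto
      finally show "outer_content (\<Union>i. A i) \<le> (\<Sum>i. outer_content (A i)) + ennreal e" .
    qed
  qed
qed

text \<open>This is the inequality that makes open sets measurable in the sense of Caratheodory. A function
  \<open>f\<close> on \<open>V \<inter> U\<close>, once truncated, vanishes off a closed set \<open>K\<close>; any function on \<open>V - K\<close> can then
  be added to it without exceeding \<open>1\<close>, and \<open>V - K\<close> still contains \<open>V - U\<close>.\<close>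

lemma open_content_split:
  assumes "openin X U" "openin X V"
  shows "open_content (V \<inter> U) + outer_content (V - U) \<le> open_content V"
proof -
  have main: "ennreal (\<Lambda> f) + outer_content (V - U) \<le> open_content V" if f: "bump f (V \<inter> U)" for f
  proof (rule ennreal_le_epsilon)
    fix e :: real assume e: "e > 0"
    define K where "K = {x \<in> topspace X. e \<le> f x}"
    \<comment> \<open>Truncation leaves room for a second function on the part of the set that it vacates.\<close>
    define f' where "f' = (\<lambda>x. max 0 (f x - e))"
    note t = bump_truncate[OF f e, folded K_def f'_def]
    have W: "openin X (V - K)" by (rule openin_diff[OF assms(2) t(3)])
    have "outer_content (V - U) \<le> open_content (V - K)"
      using t(2) by (intro outer_content_le W) auto
    moreover have "ennreal (\<Lambda> f') + open_content (V - K) \<le> open_content V"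
      unfolding open_content_def[of "V - K"]
    proof (subst ennreal_SUP_add_right)
      show "{f. bump f (V - K)} \<noteq> {}" using bump_0 by auto
      show "(SUP g\<in>{g. bump g (V - K)}. ennreal (\<Lambda> f') + ennreal (\<Lambda> g)) \<le> open_content V"
      proof (rule SUP_least)
        fix g assume "g \<in> {g. bump g (V - K)}"
        then have g: "bump g (V - K)" by simp
        have "bump (\<lambda>x. f' x + g x) V"
          unfolding bump_def
        proof (intro conjI ballI)
          fix x assume x: "x \<in> topspace X"
          show "f' x + g x \<le> 1"
            using t(1) g x by (cases "x \<in> K") (auto simp: bump_def)
        qed (use t(1,2) g in \<open>auto simp: bump_def intro!: continuous_intros\<close>)
        from \<Lambda>_le_open_content[OF this]
        have "ennreal (\<Lambda> f' + \<Lambda> g) \<le> open_content V"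
          using add[of f' g] t(1) g by (simp add: bump_def)
        then show "ennreal (\<Lambda> f') + ennreal (\<Lambda> g) \<le> open_content V"
          using \<Lambda>_nonneg[OF t(1)] \<Lambda>_nonneg[OF g] by simp
      qed
    qed
    moreover have "ennreal (\<Lambda> f) \<le> ennreal (\<Lambda> f') + ennreal e"
      using t(4) \<Lambda>_nonneg[OF t(1)] e by (simp add: ennreal_plus[symmetric] ennreal_leI del: ennreal_plus)
    ultimately show "ennreal (\<Lambda> f) + outer_content (V - U) \<le> open_content V + ennreal e"
    proof -
      assume 1: "outer_content (V - U) \<le> open_content (V - K)"
        and 2: "ennreal (\<Lambda> f') + open_content (V - K) \<le> open_content V"
        and 3: "ennreal (\<Lambda> f) \<le> ennreal (\<Lambda> f') + ennreal e"
      have "ennreal (\<Lambda> f) + outer_content (V - U) \<le> (ennreal (\<Lambda> f') + ennreal e) + open_content (V - K)"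
        by (rule add_mono[OF 3 1])
      also have "\<dots> = (ennreal (\<Lambda> f') + open_content (V - K)) + ennreal e"
        by (simp add: ac_simps)
      also have "\<dots> \<le> open_content V + ennreal e"
        by (rule add_right_mono[OF 2])
      finally show ?thesis .
    qed
  qed
  show ?thesis
    unfolding open_content_def[of "V \<inter> U"]
  proof (subst ennreal_SUP_add_left[symmetric])
    show "{f. bump f (V \<inter> U)} \<noteq> {}" using bump_0 by auto
    show "(SUP f\<in>{f. bump f (V \<inter> U)}. ennreal (\<Lambda> f) + outer_content (V - U)) \<le> open_content V"
      by (rule SUP_least) (simp add: main)
  qed
qed

definition representing_measure :: "'a measure" where
  "representing_measure = measure_of (topspace X) (sigma_sets (topspace X) {U. openin X U}) outer_content"

lemma opens_subset_Pow: "{U. openin X U} \<subseteq> Pow (topspace X)"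
  using openin_subset by auto

lemma sigma_algebra_opens: "sigma_algebra (topspace X) (sigma_sets (topspace X) {U. openin X U})"
  by (rule sigma_algebra_sigma_sets[OF opens_subset_Pow])

lemma sets_borel_of_topology: "sets (borel_of_topology X) = sigma_sets (topspace X) {U. openin X U}"
  unfolding borel_of_topology_def by (rule sets_measure_of[OF opens_subset_Pow])

lemma sets_representing_measure: "sets representing_measure = sets (borel_of_topology X)"
  unfolding representing_measure_def sets_borel_of_topology
  by (rule sigma_algebra.sets_measure_of_eq[OF sigma_algebra_opens])

lemma space_representing_measure: "space representing_measure = topspace X"
  unfolding representing_measure_def by (rule sigma_algebra.space_measure_of_eq[OF sigma_algebra_opens])

text \<open>By Caratheodory's theorem the outer measure is a measure on the sets that split every set
  additively, and these include the open sets.\<close>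

lemma emeasure_representing_measure:
  assumes "B \<in> sets (borel_of_topology X)"
  shows "emeasure representing_measure B = outer_content B"
proof -
  interpret P: sigma_algebra "topspace X" "Pow (topspace X)"
    by (rule sigma_algebra_Pow)
  let ?L = "lambda_system (topspace X) (Pow (topspace X)) outer_content"
  have pos: "positive (Pow (topspace X)) outer_content"
    and csa: "countably_subadditive (Pow (topspace X)) outer_content"
    using outer_measure_space_outer_content by (auto simp: outer_measure_space_def)
  have L: "measure_space (topspace X) ?L outer_content"
    by (rule P.caratheodory_lemma[OF outer_measure_space_outer_content])
  have openL: "U \<in> ?L" if U: "openin X U" for U
    unfolding lambda_system_def
  proof (intro CollectI conjI ballI)
    show "U \<in> Pow (topspace X)" using openin_subset[OF U] by simp
    fix A assume A: "A \<in> Pow (topspace X)"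
    have sub: "subadditive (Pow (topspace X)) outer_content"
      by (rule P.countably_subadditive_subadditive[OF pos csa])
    have eq: "(U \<inter> A) \<union> ((topspace X - U) \<inter> A) = A" using A by auto
    have "outer_content ((U \<inter> A) \<union> ((topspace X - U) \<inter> A))
        \<le> outer_content (U \<inter> A) + outer_content ((topspace X - U) \<inter> A)"
      by (rule subadditiveD[OF sub]) (use A in auto)
    then have "outer_content A \<le> outer_content (U \<inter> A) + outer_content ((topspace X - U) \<inter> A)"
      by (simp only: eq)
    moreover have "outer_content (U \<inter> A) + outer_content ((topspace X - U) \<inter> A) \<le> outer_content A"
      unfolding outer_content_def[of A]
    proof (rule INF_greatest)
      fix V assume "V \<in> {U. openin X U \<and> A \<subseteq> U}"
      then have V: "openin X V" "A \<subseteq> V" by auto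
      have "outer_content (U \<inter> A) \<le> open_content (V \<inter> U)"
        using V U by (intro outer_content_le) auto
      moreover have "outer_content ((topspace X - U) \<inter> A) \<le> outer_content (V - U)"
        using V by (intro outer_content_mono) auto
      ultimately show "outer_content (U \<inter> A) + outer_content ((topspace X - U) \<inter> A) \<le> open_content V"
        using open_content_split[OF U V(1)] by (meson add_mono order_trans)
    qed
    ultimately show "outer_content (U \<inter> A) + outer_content ((topspace X - U) \<inter> A) = outer_content A"
      by simp
  qed
  have sub: "sigma_sets (topspace X) {U. openin X U} \<subseteq> ?L"
    using L openL by (intro sigma_algebra.sigma_sets_subset) (auto simp: measure_space_def)
  show ?thesis
    unfolding representing_measure_def
  proof (rule emeasure_measure_of_sigma[OF sigma_algebra_opens])
    show "positive (sigma_sets (topspace X) {U. openin X U}) outer_content"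
      using pos by (simp add: positive_def)
    show "countably_additive (sigma_sets (topspace X) {U. openin X U}) outer_content"
      using L sub unfolding measure_space_def countably_additive_def by (meson order_trans subsetD)
    show "B \<in> sigma_sets (topspace X) {U. openin X U}"
      using assms by (simp only: sets_borel_of_topology)
  qed
qed

lemma openin_imp_borel: "openin X U \<Longrightarrow> U \<in> sets (borel_of_topology X)"
  unfolding sets_borel_of_topology by (rule sigma_sets.Basic) simp

lemma space_borel_of_topology: "space (borel_of_topology X) = topspace X"
  unfolding borel_of_topology_def by (rule space_measure_of[OF opens_subset_Pow])

lemma continuous_map_measurable:
  assumes T: "continuous_map X X T"
    and M: "sets M = sets (borel_of_topology X)" "sets N = sets (borel_of_topology X)"
  shows "T \<in> measurable M N"
proof -
  have "T \<in> measurable (borel_of_topology X) (sigma (topspace X) {U. openin X U})"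
  proof (rule measurable_measure_of[OF opens_subset_Pow])
    show "T \<in> space (borel_of_topology X) \<rightarrow> topspace X"
      using continuous_map_image_subset_topspace[OF T] by (auto simp: space_borel_of_topology)
    fix U assume "U \<in> {U. openin X U}"
    then have "openin X (T -` U \<inter> topspace X)"
      using openin_continuous_map_preimage[OF T, of U] by (simp add: vimage_def Int_def conj_commute)
    then show "T -` U \<inter> space (borel_of_topology X) \<in> sets (borel_of_topology X)"
      by (simp only: space_borel_of_topology openin_imp_borel)
  qed
  then show ?thesis
    using measurable_cong_sets[OF M] by (simp only: borel_of_topology_def)
qed

lemma prob_space_representing_measure: "prob_space representing_measure"
proof
  show "emeasure representing_measure (space representing_measure) = 1"
    by (simp only: space_representing_measure openin_topspace openin_imp_borel
        emeasure_representing_measure outer_content_open open_content_topspace)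
qed

text \<open>For a probability measure on a compact space, inner regularity of \<open>B\<close> is outer regularity of the
  complement of \<open>B\<close>.\<close>

lemma regular_measureI:
  assumes "prob_space M" and sets_M: "sets M = sets (borel_of_topology X)" and space_M: "space M = topspace X"
    and outer: "\<And>B. B \<in> sets M \<Longrightarrow> emeasure M B = (INF U\<in>{U. openin X U \<and> B \<subseteq> U}. emeasure M U)"
  shows "regular_measure X M"
  unfolding regular_measure_def
proof (intro ballI conjI outer)
  interpret M: prob_space M by fact
  fix B assume B: "B \<in> sets M"
  show "emeasure M B = (SUP K\<in>{K. compactin X K \<and> K \<subseteq> B}. emeasure M K)"
  proof (rule antisym)
    show "(SUP K\<in>{K. compactin X K \<and> K \<subseteq> B}. emeasure M K) \<le> emeasure M B"
      by (rule SUP_least) (use B in \<open>auto intro: emeasure_mono\<close>)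
    show "emeasure M B \<le> (SUP K\<in>{K. compactin X K \<and> K \<subseteq> B}. emeasure M K)"
    proof (rule ennreal_le_epsilon)
      fix e :: real assume e: "e > 0"
      have B': "topspace X - B \<in> sets M"
        using B sets.compl_sets[OF B] by (simp add: space_M)
      have "emeasure M (topspace X - B) < emeasure M (topspace X - B) + ennreal e"
        using e by (simp add: ennreal_add_left_cancel_less M.emeasure_eq_measure)
      then have "(INF U\<in>{U. openin X U \<and> topspace X - B \<subseteq> U}. emeasure M U) < emeasure M (topspace X - B) + ennreal e"
        using outer[OF B'] by simp
      then obtain U where U: "openin X U" "topspace X - B \<subseteq> U" "emeasure M U < emeasure M (topspace X - B) + ennreal e"
        unfolding INF_less_iff by auto
      have US: "U \<in> sets M" using openin_imp_borel[OF U(1)] by (simp add: sets_M)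
      have K: "compactin X (topspace X - U)"
        by (rule closedin_compact_space[OF compact_X]) (use U(1) in auto)
      have "measure M U \<le> measure M (topspace X - B) + e"
      proof -
        have "ennreal (measure M U) < ennreal (measure M (topspace X - B)) + ennreal e"
          using U(3) by (simp add: M.emeasure_eq_measure)
        then have "ennreal (measure M U) \<le> ennreal (measure M (topspace X - B) + e)"
          using e by (simp add: less_imp_le)
        then show ?thesis using e by (subst (asm) ennreal_le_iff) auto
      qed
      then have "measure M B \<le> measure M (topspace X - U) + e"
        using M.prob_compl[OF B] M.prob_compl[OF US] by (simp add: space_M)
      then have "emeasure M B \<le> emeasure M (topspace X - U) + ennreal e"
        using e by (simp add: M.emeasure_eq_measure ennreal_plus[symmetric] ennreal_leI del: ennreal_plus)
      also have "\<dots> \<le> (SUP K\<in>{K. compactin X K \<and> K \<subseteq> B}. emeasure M K) + ennreal e"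
        using K U(2) openin_subset[OF U(1)] by (intro add_right_mono SUP_upper) auto
      finally show "emeasure M B \<le> (SUP K\<in>{K. compactin X K \<and> K \<subseteq> B}. emeasure M K) + ennreal e" .
    qed
  qed
qed

lemma regular_representing_measure: "regular_measure X representing_measure"
proof (rule regular_measureI[OF prob_space_representing_measure sets_representing_measure space_representing_measure])
  fix B assume "B \<in> sets representing_measure"
  then have "emeasure representing_measure B = outer_content B"
    by (simp only: sets_representing_measure emeasure_representing_measure)
  also have "\<dots> = (INF U\<in>{U. openin X U \<and> B \<subseteq> U}. emeasure representing_measure U)"
    unfolding outer_content_def[of B]
    by (rule INF_cong) (auto simp: emeasure_representing_measure openin_imp_borel outer_content_open)
  finally show "emeasure representing_measure B = (INF U\<in>{U. openin X U \<and> B \<subseteq> U}. emeasure representing_measure U)" .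
qed

lemma continuous_map_borel_measurable:
  assumes "continuous_map X euclideanreal g" "sets M = sets (borel_of_topology X)" "space M = topspace X"
  shows "g \<in> borel_measurable M"
proof (rule borel_measurableI)
  fix S :: "real set" assume "open S"
  then have "openin X {x \<in> topspace X. g x \<in> S}"
    by (intro openin_continuous_map_preimage[OF assms(1)]) simp
  moreover have "g -` S \<inter> space M = {x \<in> topspace X. g x \<in> S}"
    by (auto simp: assms(3))
  ultimately show "g -` S \<inter> space M \<in> sets M"
    by (simp add: assms(2) openin_imp_borel)
qed

lemma nn_integral_bump:
  assumes "prob_space M" "sets M = sets (borel_of_topology X)" "space M = topspace X" "bump f U"
  shows "(\<integral>\<^sup>+x. ennreal (f x) \<partial>M) = ennreal (\<integral>x. f x \<partial>M)"
proof (rule nn_integral_eq_integral)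
  interpret M: prob_space M by fact
  show "integrable M f"
    using assms(3,4) by (intro M.integrable_const_bound[of _ 1] continuous_map_borel_measurable[OF _ assms(2,3)])
       (auto simp: bump_def)
  show "AE x in M. 0 \<le> f x"
    using assms(3,4) by (auto simp: bump_def)
qed

text \<open>Urysohn functions squeeze the measure of an open set between the integrals of bump functions, so
  the integrals determine it; outer regularity extends this to all Borel sets.\<close>

theorem regular_measure_eq_outer_content:
  assumes M: "prob_space M" "sets M = sets (borel_of_topology X)" "regular_measure X M"
    and int: "\<And>g. continuous_map X euclideanreal g \<Longrightarrow> (\<integral>x. g x \<partial>M) = \<Lambda> g"
    and B: "B \<in> sets M"
  shows "emeasure M B = outer_content B"
proof -
  interpret M: prob_space M by fact
  have space_M: "space M = topspace X"
    using sets_eq_imp_space_eq[OF M(2)] by (simp only: space_borel_of_topology)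
  have openM: "U \<in> sets M" if "openin X U" for U
    using openin_imp_borel[OF that] by (simp add: M(2))
  have "emeasure M U = open_content U" if U: "openin X U" for U
  proof (rule antisym)
    show "open_content U \<le> emeasure M U"
    proof (rule open_content_le)
      fix f assume f: "bump f U"
      have "ennreal (\<Lambda> f) = (\<integral>\<^sup>+x. ennreal (f x) \<partial>M)"
        using nn_integral_bump[OF M(1,2) space_M f] int f by (simp add: bump_def)
      also have "\<dots> \<le> (\<integral>\<^sup>+x. indicator U x \<partial>M)"
      proof (rule nn_integral_mono)
        fix x assume "x \<in> space M"
        then show "ennreal (f x) \<le> indicator U x"
          using f by (cases "x \<in> U") (auto simp: bump_def space_M)
      qed
      also have "\<dots> = emeasure M U" by (rule nn_integral_indicator[OF openM[OF U]])
      finally show "ennreal (\<Lambda> f) \<le> emeasure M U" .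
    qed
    have "emeasure M K \<le> open_content U" if K: "compactin X K" "K \<subseteq> U" for K
    proof -
      have clK: "closedin X K" by (rule compactin_imp_closedin[OF Hausdorff_X K(1)])
      have "closedin X (topspace X - U)" "K \<inter> (topspace X - U) = {}"
        using U K(2) by auto
      then obtain f where f: "continuous_map X euclideanreal f" "\<And>x. x \<in> topspace X \<Longrightarrow> 0 \<le> f x \<and> f x \<le> 1"
          "\<And>x. x \<in> K \<Longrightarrow> f x = 1" "\<And>x. x \<in> topspace X - U \<Longrightarrow> f x = 0"
        using Urysohn_bump[OF compact_X Hausdorff_X clK] by blast
      then have bf: "bump f U" by (simp add: bump_def)
      have "K \<in> sets M"
        using sets.compl_sets[OF openM[OF openin_diff[OF openin_topspace clK]]] closedin_subset[OF clK]
        by (simp add: space_M double_diff)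
      then have "emeasure M K = (\<integral>\<^sup>+x. indicator K x \<partial>M)" by simp
      also have "\<dots> \<le> (\<integral>\<^sup>+x. ennreal (f x) \<partial>M)"
      proof (rule nn_integral_mono)
        fix x show "indicator K x \<le> ennreal (f x)"
          using f(3)[of x] by (cases "x \<in> K") auto
      qed
      also have "\<dots> = ennreal (\<Lambda> f)"
        using nn_integral_bump[OF M(1,2) space_M bf] int[OF f(1)] by simp
      also have "\<dots> \<le> open_content U" by (rule \<Lambda>_le_open_content[OF bf])
      finally show ?thesis .
    qed
    then have "(SUP K\<in>{K. compactin X K \<and> K \<subseteq> U}. emeasure M K) \<le> open_content U"
      by (intro SUP_least) auto
    then show "emeasure M U \<le> open_content U"
      using M(3) openM[OF U] unfolding regular_measure_def by metis
  qed
  then have "(INF U\<in>{U. openin X U \<and> B \<subseteq> U}. emeasure M U) = outer_content B"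
    unfolding outer_content_def by (intro INF_cong) auto
  with M(3) B show ?thesis unfolding regular_measure_def by auto
qed

text \<open>If \<open>f\<close> is a bump function on \<open>U\<close>, then \<open>f \<circ> T\<close> is one on the preimage of \<open>U\<close>.\<close>

lemma open_content_le_vimage:
  assumes T: "continuous_map X X T"
    and inv: "\<And>g. continuous_map X euclideanreal g \<Longrightarrow> \<Lambda> (g \<circ> T) = \<Lambda> g"
  shows "open_content U \<le> open_content (T -` U \<inter> topspace X)"
proof (rule open_content_le)
  fix f assume f: "bump f U"
  have "T x \<in> topspace X" if "x \<in> topspace X" for x
    using continuous_map_image_subset_topspace[OF T] that by auto
  then have "bump (f \<circ> T) (T -` U \<inter> topspace X)"
    using f continuous_map_compose[OF T, of euclideanreal f] by (auto simp: bump_def)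
  from \<Lambda>_le_open_content[OF this] show "ennreal (\<Lambda> f) \<le> open_content (T -` U \<inter> topspace X)"
    using inv f by (simp add: bump_def)
qed

lemma \<Lambda>_cong:
  assumes "continuous_map X euclideanreal f" "continuous_map X euclideanreal g"
    "\<And>x. x \<in> topspace X \<Longrightarrow> f x = g x"
  shows "\<Lambda> f = \<Lambda> g"
  using mono[OF assms(1,2)] mono[OF assms(2,1)] assms(3) by (simp add: antisym)

text \<open>Stated for a pair of mutually inverse maps, so that exchanging their roles gives the reverse
  inequality.\<close>

lemma outer_content_vimage_le:
  assumes T: "continuous_map X X T" and S: "continuous_map X X S"
    and TS: "\<And>x. x \<in> topspace X \<Longrightarrow> T (S x) = x" and ST: "\<And>x. x \<in> topspace X \<Longrightarrow> S (T x) = x"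
    and inv: "\<And>g. continuous_map X euclideanreal g \<Longrightarrow> \<Lambda> (g \<circ> S) = \<Lambda> g"
  shows "outer_content (T -` B \<inter> topspace X) \<le> outer_content B"
  unfolding outer_content_def[of B]
proof (rule INF_greatest)
  fix U assume "U \<in> {U. openin X U \<and> B \<subseteq> U}"
  then have U: "openin X U" "B \<subseteq> U" by auto
  have topT: "T x \<in> topspace X" "S x \<in> topspace X" if "x \<in> topspace X" for x
    using continuous_map_image_subset_topspace[OF T] continuous_map_image_subset_topspace[OF S] that by auto
  have "openin X (T -` U \<inter> topspace X)"
    using openin_continuous_map_preimage[OF T U(1)] by (simp add: vimage_def Int_def conj_commute)
  then have "outer_content (T -` B \<inter> topspace X) \<le> open_content (T -` U \<inter> topspace X)"
    using U(2) by (intro outer_content_le) auto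
  also have "\<dots> \<le> open_content (S -` (T -` U \<inter> topspace X) \<inter> topspace X)"
    by (rule open_content_le_vimage[OF S inv])
  also have "S -` (T -` U \<inter> topspace X) \<inter> topspace X = U"
    using openin_subset[OF U(1)] topT TS by auto
  finally show "outer_content (T -` B \<inter> topspace X) \<le> open_content U" .
qed

text \<open>The outer content is made from \<open>\<Lambda>\<close> and the topology alone, and \<open>T\<close> preserves both.\<close>

theorem representing_measure_invariant:
  assumes T: "homeomorphic_map X X T"
    and inv: "\<And>g. continuous_map X euclideanreal g \<Longrightarrow> \<Lambda> (g \<circ> T) = \<Lambda> g"
  shows "invariant_probability X T representing_measure"
proof -
  obtain S where S: "homeomorphic_maps X X T S"
    using T homeomorphic_map_maps by blast
  then have cT: "continuous_map X X T" and cS: "continuous_map X X S"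
    and ST: "\<And>x. x \<in> topspace X \<Longrightarrow> S (T x) = x" and TS: "\<And>x. x \<in> topspace X \<Longrightarrow> T (S x) = x"
    by (auto simp: homeomorphic_maps_def)
  have topT: "T x \<in> topspace X" if "x \<in> topspace X" for x
    using continuous_map_image_subset_topspace[OF cT] that by auto
  have topS: "S x \<in> topspace X" if "x \<in> topspace X" for x
    using continuous_map_image_subset_topspace[OF cS] that by auto
  have invS: "\<Lambda> (g \<circ> S) = \<Lambda> g" if g: "continuous_map X euclideanreal g" for g
  proof -
    have gS: "continuous_map X euclideanreal (g \<circ> S)" by (rule continuous_map_compose[OF cS g])
    have "\<Lambda> (g \<circ> S) = \<Lambda> ((g \<circ> S) \<circ> T)" using inv[OF gS] by simp
    also have "\<dots> = \<Lambda> g"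
      using continuous_map_compose[OF cT gS] g ST by (intro \<Lambda>_cong) auto
    finally show ?thesis .
  qed
  have "emeasure representing_measure (T -` B \<inter> topspace X) = emeasure representing_measure B"
    if B: "B \<in> sets representing_measure" for B
  proof -
    have Bsub: "B \<subseteq> topspace X"
      using sets.sets_into_space[OF B] by (simp add: space_representing_measure)
    have vim: "T -` B \<inter> topspace X \<in> sets (borel_of_topology X)"
      using measurable_sets[OF continuous_map_measurable[OF cT refl refl], of B] B
      by (simp only: sets_representing_measure space_borel_of_topology)
    have "outer_content (T -` B \<inter> topspace X) \<le> outer_content B"
      by (rule outer_content_vimage_le[OF cT cS TS ST invS])
    moreover have "outer_content (S -` (T -` B \<inter> topspace X) \<inter> topspace X) \<le> outer_content (T -` B \<inter> topspace X)"
      by (rule outer_content_vimage_le[OF cS cT ST TS inv])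
    moreover have "S -` (T -` B \<inter> topspace X) \<inter> topspace X = B"
      using Bsub topS TS by auto
    ultimately show ?thesis
      using vim B by (simp add: emeasure_representing_measure sets_representing_measure)
  qed
  then show ?thesis
    unfolding invariant_probability_def
    using prob_space_representing_measure sets_representing_measure regular_representing_measure by blast
qed

text \<open>The representing measure is invariant, and any other invariant measure has the same integrals and
  hence the same values on Borel sets.\<close>

theorem uniquely_ergodic_if_integrals_determined:
  assumes T: "homeomorphic_map X X T"
    and inv: "\<And>g. continuous_map X euclideanreal g \<Longrightarrow> \<Lambda> (g \<circ> T) = \<Lambda> g"
    and int: "\<And>M g. invariant_probability X T M \<Longrightarrow> continuous_map X euclideanreal g \<Longrightarrow> (\<integral>x. g x \<partial>M) = \<Lambda> g"
  shows "uniquely_ergodic X T"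
  unfolding uniquely_ergodic_def is_flow_def
proof (intro conjI compact_X Hausdorff_X T ex1I)
  show "invariant_probability X T representing_measure"
    by (rule representing_measure_invariant[OF T inv])
  fix M assume M: "invariant_probability X T M"
  then have M': "prob_space M" "sets M = sets (borel_of_topology X)" "regular_measure X M"
    by (auto simp: invariant_probability_def)
  show "M = representing_measure"
  proof (rule measure_eqI)
    show "sets M = sets representing_measure" by (simp add: M'(2) sets_representing_measure)
    fix B assume "B \<in> sets M"
    then show "emeasure M B = emeasure representing_measure B"
      using regular_measure_eq_outer_content[OF M' int[OF M]] M'(2)
      by (simp add: emeasure_representing_measure)
  qed
qed

end

section \<open>Orbit closures whose coordinates have means and returns\<close>

definition uniform_mean :: "(int \<Rightarrow> complex) \<Rightarrow> complex" where
  "uniform_mean f = (THE c. has_uniform_mean f c)"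

lemma has_uniform_mean_tendsto:
  "has_uniform_mean f c \<Longrightarrow> (\<lambda>N. window_average f N k) \<longlonglongrightarrow> c"
  unfolding has_uniform_mean_def by (erule tendsto_uniform_limitI) simp

lemma uniform_mean_eq: "has_uniform_mean f c \<Longrightarrow> uniform_mean f = c"
  unfolding uniform_mean_def
  by (rule the_equality) (blast intro: LIMSEQ_unique has_uniform_mean_tendsto)+

text \<open>The Gelfand flow of a \<open>T\<close>-subalgebra and the orbit closures of its elements are both closures of
  points \<open>(h\<^sub>i(n))\<^sub>i\<close> on which the shift permutes coordinates. Means yield unique ergodicity and
  syndetic returns yield minimality. Only on the closure is \<open>T\<close> required to be the permutation, as
  the maps of interest may differ from it elsewhere.\<close>

locale mean_recurrent_flow =
  fixes A :: "(int \<Rightarrow> complex) set"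
    and h :: "'i \<Rightarrow> int \<Rightarrow> complex" and \<sigma> :: "'i \<Rightarrow> 'i" and T :: "('i \<Rightarrow> complex) \<Rightarrow> 'i \<Rightarrow> complex"
  assumes algebra: "T_subalgebra A"
    and has_mean: "\<And>f. f \<in> A \<Longrightarrow> \<exists>c. has_uniform_mean f c"
    and returns: "\<And>F m e. finite F \<Longrightarrow> F \<subseteq> A \<Longrightarrow> e > 0 \<Longrightarrow>
      syndetic {n. \<forall>f\<in>F. cmod (f n - f m) < e}"
    and h_in: "\<And>i. h i \<in> A"
    and bij: "bij \<sigma>"
    and h_\<sigma>: "\<And>i n. h (\<sigma> i) n = h i (n + 1)"
    and T_eq: "\<And>x. x \<in> closure (range (\<lambda>n i. h i n)) \<Longrightarrow> T x = x \<circ> \<sigma>"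
begin

definition point :: "int \<Rightarrow> 'i \<Rightarrow> complex" where
  "point n = (\<lambda>i. h i n)"

definition points :: "('i \<Rightarrow> complex) set" where
  "points = closure (range point)"

lemma point_in_points: "point n \<in> points"
  unfolding points_def using closure_subset by fast

lemma compact_points: "compact points"
  unfolding points_def
proof (rule compact_closure_fun)
  fix i
  have "h i \<in> linf" using T_subalgebra_subset_linf[OF algebra] h_in by blast
  then show "bounded ((\<lambda>s. s i) ` range point)"
    by (simp add: linf_def point_def image_image)
qed

lemma T_points: "x \<in> points \<Longrightarrow> T x = x \<circ> \<sigma>"
  using T_eq by (simp add: points_def point_def)

lemma point_\<sigma>: "point n \<circ> \<sigma> = point (n + 1)"
  by (simp add: fun_eq_iff point_def h_\<sigma>)

lemma T_point: "T (point n) = point (n + 1)"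
  by (simp add: T_points point_in_points point_\<sigma>)

lemma \<sigma>_inv: "\<sigma> \<circ> inv \<sigma> = id" and inv_\<sigma>: "inv \<sigma> \<circ> \<sigma> = id"
  using bij by (simp_all add: fun_eq_iff bij_is_surj surj_f_inv_f bij_is_inj)

lemma point_inv_\<sigma>: "point n \<circ> inv \<sigma> = point (n - 1)"
proof -
  have "point n \<circ> inv \<sigma> = point (n - 1) \<circ> (\<sigma> \<circ> inv \<sigma>)"
    using point_\<sigma>[of "n - 1"] by (simp add: o_assoc)
  then show ?thesis by (simp add: \<sigma>_inv)
qed

lemma continuous_on_compose_index: "continuous_on B (\<lambda>x :: 'i \<Rightarrow> complex. x \<circ> \<tau>)"
  unfolding comp_def by (intro continuous_on_coordinatewise_then_product continuous_on_coordinate)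

lemma T_in_points: "x \<in> points \<Longrightarrow> T x \<in> points"
proof -
  have "(\<lambda>x. x \<circ> \<sigma>) ` points \<subseteq> points"
    unfolding points_def
    by (rule image_closure_subset[OF continuous_on_compose_index closed_closure])
       (use point_in_points in \<open>auto simp: point_\<sigma> points_def[symmetric]\<close>)
  then show "x \<in> points \<Longrightarrow> T x \<in> points" by (auto simp: T_points)
qed

lemma inv_in_points: "x \<in> points \<Longrightarrow> x \<circ> inv \<sigma> \<in> points"
proof -
  have "(\<lambda>x. x \<circ> inv \<sigma>) ` points \<subseteq> points"
    unfolding points_def
    by (rule image_closure_subset[OF continuous_on_compose_index closed_closure])
       (use point_in_points in \<open>auto simp: point_inv_\<sigma> points_def[symmetric]\<close>)
  then show "x \<in> points \<Longrightarrow> x \<circ> inv \<sigma> \<in> points" by auto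
qed

lemma continuous_on_T: "continuous_on points T"
  by (rule continuous_on_eq[OF continuous_on_compose_index[of points \<sigma>]]) (simp add: T_points)

lemma homeomorphic_T: "homeomorphic_map (top_of_set points) (top_of_set points) T"
proof (rule homeomorphic_maps_imp_map)
  show "homeomorphic_maps (top_of_set points) (top_of_set points) T (\<lambda>x. x \<circ> inv \<sigma>)"
    unfolding homeomorphic_maps_def
  proof (intro conjI ballI)
    show "continuous_map (top_of_set points) (top_of_set points) T"
      using T_in_points by (auto simp: continuous_map_in_subtopology continuous_on_T)
    show "continuous_map (top_of_set points) (top_of_set points) (\<lambda>x. x \<circ> inv \<sigma>)"
      using inv_in_points by (auto simp: continuous_map_in_subtopology continuous_on_compose_index)
    fix x assume x: "x \<in> topspace (top_of_set points)"
    then show "T x \<circ> inv \<sigma> = x"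
      by (simp add: T_points comp_assoc \<sigma>_inv)
    show "T (x \<circ> inv \<sigma>) = x"
      using x by (simp add: T_points inv_in_points comp_assoc inv_\<sigma>)
  qed
qed

lemma funpow_T:
  assumes "x \<in> points"
  shows "(T ^^ n) x \<in> points" "(T ^^ n) x = x \<circ> (\<sigma> ^^ n)"
proof -
  have "(T ^^ n) x \<in> points \<and> (T ^^ n) x = x \<circ> (\<sigma> ^^ n)"
    using assms
  proof (induction n)
    case (Suc n)
    then have IH: "(T ^^ n) x \<in> points" "(T ^^ n) x = x \<circ> (\<sigma> ^^ n)" by blast+
    have mem: "(T ^^ Suc n) x \<in> points"
      using T_in_points[OF IH(1)] by simp
    have "(T ^^ Suc n) x = (T ^^ n) x \<circ> \<sigma>"
      using T_points[OF IH(1)] by simp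
    also have "\<dots> = x \<circ> (\<sigma> ^^ n) \<circ> \<sigma>"
      by (simp only: IH(2))
    also have "\<dots> = x \<circ> (\<sigma> ^^ Suc n)"
      by (simp add: comp_assoc funpow_Suc_right del: funpow.simps)
    finally show ?case
      using mem by blast
  qed simp
  then show "(T ^^ n) x \<in> points" "(T ^^ n) x = x \<circ> (\<sigma> ^^ n)" by auto
qed

lemma funpow_T_point: "(T ^^ j) (point n) = point (n + int j)"
  by (induction j) (simp_all add: T_point algebra_simps)

text \<open>The continuous functions on the orbit closure with this property form an algebra. It contains
  the real and imaginary parts of the coordinates, which separate points, and it is uniformly
  closed, so it is everything by Stone--Weierstrass.\<close>

lemma continuous_function_along_orbit:
  assumes g: "continuous_on points (g :: _ \<Rightarrow> real)"
  shows "(\<lambda>n. complex_of_real (g (point n))) \<in> A"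
proof -
  note closed = T_subalgebra_const[OF algebra] T_subalgebra_add[OF algebra] T_subalgebra_mult[OF algebra]
    T_subalgebra_cmult[OF algebra] T_subalgebra_cnj[OF algebra]
  define P where "P = (\<lambda>g. continuous_on points g \<and> (\<lambda>n. complex_of_real (g (point n))) \<in> A)"
  have approx: "\<exists>g'. P g' \<and> (\<forall>x\<in>points. \<bar>g x - g' x\<bar> < e)" if e: "e > 0" for e
  proof (rule Stone_Weierstrass_HOL[where P=P and S=points])
    show "P (\<lambda>x. c)" for c by (simp add: P_def closed)
    show "P f \<and> P g \<Longrightarrow> P (\<lambda>x. f x + g x)" for f g
      using closed(2) by (auto simp: P_def intro: continuous_intros)
    show "P f \<and> P g \<Longrightarrow> P (\<lambda>x. f x * g x)" for f g
      using closed(3) by (auto simp: P_def intro: continuous_intros)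
    fix x y assume xy: "x \<in> points \<and> y \<in> points \<and> x \<noteq> y"
    then obtain i where i: "x i \<noteq> y i" by auto
    have "P (\<lambda>x. Re (x i))"
      unfolding P_def
    proof
      show "continuous_on points (\<lambda>x. Re (x i))"
        by (intro continuous_on_Re continuous_on_coordinate)
      have "(\<lambda>n. 1/2 * (h i n + cnj (h i n))) \<in> A"
        by (intro closed h_in)
      then show "(\<lambda>n. complex_of_real (Re (point n i))) \<in> A"
        by (simp add: complex_add_cnj point_def)
    qed
    moreover have "P (\<lambda>x. Im (x i))"
      unfolding P_def
    proof
      show "continuous_on points (\<lambda>x. Im (x i))"
        by (intro continuous_on_Im continuous_on_coordinate)
      have "(\<lambda>n. 1/(2*\<i>) * (h i n + (-1) * cnj (h i n))) \<in> A"
        by (intro closed h_in)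
      moreover have "1/(2*\<i>) * (h i n + (-1) * cnj (h i n)) = complex_of_real (Im (h i n))" for n
        by (simp add: complex_eq_iff)
      ultimately show "(\<lambda>n. complex_of_real (Im (point n i))) \<in> A"
        by (simp only: point_def)
    qed
    ultimately show "\<exists>f. P f \<and> f x \<noteq> f y"
      using i by (metis complex_eq_iff)
  qed (use g e compact_points in \<open>auto simp: P_def\<close>)
  then have "\<forall>m::nat. \<exists>g'. P g' \<and> (\<forall>x\<in>points. \<bar>g x - g' x\<bar> < 1 / real (Suc m))"
    by simp
  then obtain G where G: "\<And>m. P (G m)" "\<And>m x. x \<in> points \<Longrightarrow> \<bar>g x - G m x\<bar> < 1 / real (Suc m)"
    by metis
  show ?thesis
  proof (rule T_subalgebra_uniform_limit[OF algebra])
    show "(\<lambda>n. complex_of_real (G m (point n))) \<in> A" for m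
      using G(1) by (simp add: P_def)
    show "uniform_limit UNIV (\<lambda>m n. complex_of_real (G m (point n))) (\<lambda>n. complex_of_real (g (point n))) sequentially"
    proof (rule uniform_limitI)
      fix e :: real assume "e > 0"
      then have "\<forall>\<^sub>F m in sequentially. 1 / real (Suc m) < e"
        using order_tendstoD(2)[OF LIMSEQ_inverse_real_of_nat] by (simp add: inverse_eq_divide)
      then show "\<forall>\<^sub>F m in sequentially. \<forall>n\<in>UNIV. dist (complex_of_real (G m (point n))) (complex_of_real (g (point n))) < e"
      proof eventually_elim
        case (elim m)
        show ?case
        proof
          fix n
          have "\<bar>g (point n) - G m (point n)\<bar> < e"
            using G(2)[OF point_in_points, of n m] elim by linarith
          then show "dist (complex_of_real (G m (point n))) (complex_of_real (g (point n))) < e"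
            by (simp add: dist_norm abs_minus_commute flip: of_real_diff)
        qed
      qed
    qed
  qed
qed

definition orbit_mean :: "(('i \<Rightarrow> complex) \<Rightarrow> real) \<Rightarrow> real" where
  "orbit_mean g = Re (uniform_mean (\<lambda>n. complex_of_real (g (point n))))"

lemma has_uniform_mean_orbit:
  "continuous_on points g \<Longrightarrow>
    has_uniform_mean (\<lambda>n. complex_of_real (g (point n))) (uniform_mean (\<lambda>n. complex_of_real (g (point n))))"
  using has_mean[OF continuous_function_along_orbit] uniform_mean_eq by metis

lemma Re_window_average:
  "Re (window_average (\<lambda>n. complex_of_real (f n)) N k) = (\<Sum>j<N. f (k + int j)) / real N"
proof -
  have "window_average (\<lambda>n. complex_of_real (f n)) N k = complex_of_real ((\<Sum>j<N. f (k + int j)) / real N)"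
    by (simp add: window_average_def)
  then show ?thesis by (simp only: Re_complex_of_real)
qed

lemma orbit_mean_tendsto:
  assumes "continuous_on points g"
  shows "(\<lambda>N. (\<Sum>j<N. g (point (int j))) / real N) \<longlonglongrightarrow> orbit_mean g"
  using tendsto_Re[OF has_uniform_mean_tendsto[OF has_uniform_mean_orbit[OF assms], of 0]]
  by (simp add: Re_window_average orbit_mean_def)

sublocale normalized_functional "top_of_set points" orbit_mean
proof
  show "compact_space (top_of_set points)"
    using compact_points by (simp add: compact_space_subtopology)
  show "Hausdorff_space (top_of_set points)"
  proof (rule Hausdorff_space_subtopology)
    show "Hausdorff_space (euclidean :: ('i \<Rightarrow> complex) topology)"
      unfolding Hausdorff_space_def disjnt_def open_openin[symmetric] by (intro allI impI hausdorff) simp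
  qed
next
  fix f g :: "('i \<Rightarrow> complex) \<Rightarrow> real"
  assume fg: "continuous_map (top_of_set points) euclideanreal f" "continuous_map (top_of_set points) euclideanreal g"
  then have fg': "continuous_on points f" "continuous_on points g" by simp_all
  show "orbit_mean (\<lambda>x. f x + g x) = orbit_mean f + orbit_mean g"
    using uniform_mean_eq[OF has_uniform_mean_add[OF has_uniform_mean_orbit[OF fg'(1)] has_uniform_mean_orbit[OF fg'(2)]]]
    by (simp add: orbit_mean_def)
  assume le: "\<And>x. x \<in> topspace (top_of_set points) \<Longrightarrow> f x \<le> g x"
  show "orbit_mean f \<le> orbit_mean g"
  proof (rule LIMSEQ_le[OF orbit_mean_tendsto[OF fg'(1)] orbit_mean_tendsto[OF fg'(2)]])
    show "\<exists>N. \<forall>n\<ge>N. (\<Sum>j<n. f (point (int j))) / real n \<le> (\<Sum>j<n. g (point (int j))) / real n"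
      using le point_in_points by (intro exI[of _ 0] allI impI divide_right_mono sum_mono) auto
  qed
next
  show "orbit_mean (\<lambda>_. c) = c" for c
    using uniform_mean_eq[OF has_uniform_mean_const[of "complex_of_real c"]] by (simp add: orbit_mean_def)
qed

lemma orbit_mean_T:
  assumes "continuous_on points g"
  shows "orbit_mean (g \<circ> T) = orbit_mean g"
  using uniform_mean_eq[OF has_uniform_mean_shift[OF has_uniform_mean_orbit[OF assms], of 1]]
  by (simp add: orbit_mean_def T_point)

text \<open>Averaging \<open>g\<close> along the shift does not change its integral, and the averages are uniformly close
  to the constant \<open>orbit_mean g\<close>: on the orbit by the uniformity of the mean over all windows, and
  on the closure by continuity.\<close>

lemma integral_invariant_probability:
  assumes M: "invariant_probability (top_of_set points) T M" and g: "continuous_on points g"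
  shows "(\<integral>x. g x \<partial>M) = orbit_mean g"
proof -
  interpret M: prob_space M using M by (simp add: invariant_probability_def)
  have sets_M: "sets M = sets (borel_of_topology (top_of_set points))"
    using M by (simp add: invariant_probability_def)
  have space_M: "space M = points"
    using sets_eq_imp_space_eq[OF sets_M] by (simp add: space_borel_of_topology)
  have contT: "continuous_map (top_of_set points) (top_of_set points) T"
    using homeomorphic_T by (rule homeomorphic_imp_continuous_map)
  have measT: "T \<in> measurable M M"
    by (rule continuous_map_measurable[OF contT sets_M sets_M])
  have meas: "f \<in> borel_measurable M" if "continuous_on points f" for f :: "_ \<Rightarrow> real"
    using that by (intro continuous_map_borel_measurable[OF _ sets_M]) (simp_all add: space_M)
  have integ: "integrable M f" if f: "continuous_on points f" for f :: "_ \<Rightarrow> real"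
  proof -
    obtain B where "\<And>x. x \<in> points \<Longrightarrow> \<bar>f x\<bar> \<le> B"
      using compact_imp_bounded[OF compact_continuous_image[OF f compact_points]]
      by (auto simp: bounded_iff)
    then show ?thesis
      by (intro M.integrable_const_bound[of _ B] meas[OF f]) (auto simp: space_M)
  qed
  have distr: "distr M M T = M"
  proof (rule measure_eqI)
    fix B assume "B \<in> sets (distr M M T)"
    then have "B \<in> sets M" by simp
    then show "emeasure (distr M M T) B = emeasure M B"
      using M measT by (simp add: emeasure_distr invariant_probability_def space_M)
  qed simp
  have cont_iter: "continuous_on points (\<lambda>x. f ((T ^^ j) x))" if f: "continuous_on points f" for f :: "_ \<Rightarrow> real" and j
  proof (induction j)
    case (Suc j)
    have "continuous_on points ((\<lambda>x. f ((T ^^ j) x)) \<circ> T)"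
      by (rule continuous_on_compose[OF continuous_on_T continuous_on_subset[OF Suc]])
         (use T_in_points in auto)
    then show ?case by (simp add: comp_def funpow_swap1)
  qed (simp add: f)
  have int_iter: "(\<integral>x. f ((T ^^ j) x) \<partial>M) = (\<integral>x. f x \<partial>M)" if f: "continuous_on points f" for f :: "_ \<Rightarrow> real" and j
  proof (induction j)
    case (Suc j)
    have "(\<integral>x. f ((T ^^ Suc j) x) \<partial>M) = (\<integral>x. f ((T ^^ j) (T x)) \<partial>M)"
      by (simp add: funpow_swap1)
    also have "\<dots> = (\<integral>x. f ((T ^^ j) x) \<partial>distr M M T)"
      by (rule integral_distr[symmetric, OF measT meas[OF cont_iter[OF f]]])
    finally show ?case by (simp add: distr Suc)
  qed simp
  have "\<bar>(\<integral>x. g x \<partial>M) - orbit_mean g\<bar> \<le> e" if e: "e > 0" for e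
  proof -
    from has_uniform_meanD[OF has_uniform_mean_orbit[OF g] e]
    obtain N where N: "N > 0" "\<And>k. cmod (window_average (\<lambda>n. complex_of_real (g (point n))) N k
        - uniform_mean (\<lambda>n. complex_of_real (g (point n)))) < e"
      unfolding eventually_sequentially by (metis le_add1 le_add2 less_eq_Suc_le plus_1_eq_Suc)
    define avg where "avg x = (\<Sum>j<N. g ((T ^^ j) x)) / real N" for x
    have cont_avg: "continuous_on points avg"
      unfolding avg_def by (intro continuous_intros cont_iter[OF g]) (use N in auto)
    have orbit: "\<bar>avg (point k) - orbit_mean g\<bar> \<le> e" for k
    proof -
      have "avg (point k) = Re (window_average (\<lambda>n. complex_of_real (g (point n))) N k)"
        by (simp add: avg_def funpow_T_point Re_window_average)
      then have "avg (point k) - orbit_mean g = Re (window_average (\<lambda>n. complex_of_real (g (point n))) N k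
        - uniform_mean (\<lambda>n. complex_of_real (g (point n))))"
        by (simp add: orbit_mean_def)
      then show ?thesis
        using abs_Re_le_cmod N(2)[of k] by (metis less_eq_real_def order_trans)
    qed
    have "\<bar>avg x - orbit_mean g\<bar> \<le> e" if "x \<in> points" for x
    proof -
      have "(\<lambda>x. \<bar>avg x - orbit_mean g\<bar>) ` closure (range point) \<subseteq> {..e}"
        by (rule image_closure_subset)
           (use cont_avg orbit in \<open>auto simp: points_def intro!: continuous_intros\<close>)
      then show ?thesis using that by (auto simp: points_def)
    qed
    then have "\<bar>\<integral>x. (avg x - orbit_mean g) \<partial>M\<bar> \<le> e"
    proof -
      assume *: "\<And>x. x \<in> points \<Longrightarrow> \<bar>avg x - orbit_mean g\<bar> \<le> e"
      have i: "integrable M (\<lambda>x. avg x - orbit_mean g)"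
        by (intro integ continuous_intros cont_avg)
      have "\<bar>\<integral>x. (avg x - orbit_mean g) \<partial>M\<bar> \<le> (\<integral>x. \<bar>avg x - orbit_mean g\<bar> \<partial>M)"
        by (rule integral_abs_bound)
      also have "\<dots> \<le> (\<integral>x. e \<partial>M)"
        using * i by (intro integral_mono) (auto simp: space_M)
      finally show ?thesis by (simp add: M.prob_space)
    qed
    moreover have "(\<integral>x. (avg x - orbit_mean g) \<partial>M) = (\<integral>x. g x \<partial>M) - orbit_mean g"
    proof -
      have "(\<integral>x. avg x \<partial>M) = (\<Sum>j<N. \<integral>x. g ((T ^^ j) x) \<partial>M) / real N"
        unfolding avg_def by (simp add: integ cont_iter[OF g])
      also have "\<dots> = (\<integral>x. g x \<partial>M)"
        using N(1) by (simp add: int_iter[OF g])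
      finally show ?thesis
        using integ[OF cont_avg] by (simp add: M.prob_space)
    qed
    ultimately show ?thesis by simp
  qed
  then show ?thesis
    using field_le_epsilon[of "\<bar>(\<integral>x. g x \<partial>M) - orbit_mean g\<bar>" 0] by simp
qed

lemma uniquely_ergodic_points: "uniquely_ergodic (top_of_set points) T"
proof (rule uniquely_ergodic_if_integrals_determined[OF homeomorphic_T])
  show "orbit_mean (g \<circ> T) = orbit_mean g"
    if "continuous_map (top_of_set points) euclideanreal g" for g
    using that by (simp add: orbit_mean_T)
  show "(\<integral>x. g x \<partial>M) = orbit_mean g"
    if "invariant_probability (top_of_set points) T M" "continuous_map (top_of_set points) euclideanreal g" for M g
    using that by (simp add: integral_invariant_probability)
qed

lemma h_\<sigma>_funpow: "h ((\<sigma> ^^ j) i) n = h i (n + int j)"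
  by (induction j arbitrary: n) (simp_all add: h_\<sigma> algebra_simps)

text \<open>Since returns of the \<open>h\<^sub>i\<close> to their values at \<open>m\<close> are syndetic with some gap \<open>L\<close>, it is enough to
  approximate \<open>x\<close> by a point \<open>point k\<close> of the orbit in the coordinates visited during \<open>L\<close> steps:
  one of these steps then brings \<open>x\<close> close to \<open>point m\<close>.\<close>

lemma point_in_orbit_closure:
  assumes x: "x \<in> points"
  shows "point m \<in> closure (range (\<lambda>n. (T ^^ n) x))"
  unfolding closure_fun_iff
proof (intro allI impI)
  fix I :: "'i set" and e :: real assume I: "finite I \<and> e > 0"
  have "syndetic {n. \<forall>f\<in>h ` I. cmod (f n - f m) < e / 2}"
    using I h_in by (intro returns) auto
  then obtain L :: nat where L: "\<And>k. \<exists>j<L. \<forall>i\<in>I. cmod (h i (k + int j) - h i m) < e / 2"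
    unfolding syndetic_def by auto
  \<comment> \<open>The coordinates that the indices in \<open>I\<close> visit during \<open>L\<close> steps of the shift.\<close>
  define J where "J = (\<lambda>(j, i). (\<sigma> ^^ j) i) ` ({..<L} \<times> I)"
  have "finite J" using I by (simp add: J_def)
  then obtain k where k: "\<And>i. i \<in> J \<Longrightarrow> dist (point k i) (x i) < e / 2"
    using x I unfolding points_def closure_fun_iff by (metis half_gt_zero rangeE)
  obtain j where j: "j < L" "\<And>i. i \<in> I \<Longrightarrow> cmod (h i (k + int j) - h i m) < e / 2"
    using L by blast
  have "dist ((T ^^ j) x i) (point m i) < e" if i: "i \<in> I" for i
  proof -
    have "(\<sigma> ^^ j) i \<in> J" using i j(1) by (auto simp: J_def)
    from k[OF this] have "cmod (h i (k + int j) - (T ^^ j) x i) < e / 2"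
      by (simp add: dist_norm point_def h_\<sigma>_funpow funpow_T(2)[OF x])
    with j(2)[OF i] show ?thesis
      using norm_triangle_ineq4[of "h i (k + int j) - h i m" "h i (k + int j) - (T ^^ j) x i"]
      by (simp add: dist_norm point_def)
  qed
  then show "\<exists>s\<in>range (\<lambda>n. (T ^^ n) x). \<forall>i\<in>I. dist (s i) (point m i) < e"
    by blast
qed

lemma minimal_points: "minimal_flow (top_of_set points) T"
  unfolding minimal_flow_def
proof (intro conjI ballI)
  show "is_flow (top_of_set points) T"
    using uniquely_ergodic_points by (simp add: uniquely_ergodic_def)
  fix x assume "x \<in> topspace (top_of_set points)"
  then have x: "x \<in> points" by simp
  have "(T ^^ n) x \<in> range (\<lambda>n. flow_power (top_of_set points) T n x)" for n
    by (rule range_eqI[of _ _ "int n"]) (simp add: flow_power_def)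
  then have "range (\<lambda>n. (T ^^ n) x) \<subseteq> points \<inter> range (\<lambda>n. flow_power (top_of_set points) T n x)"
    using funpow_T(1)[OF x] by blast
  then have "closure (range (\<lambda>n. (T ^^ n) x)) \<subseteq> closure (points \<inter> range (\<lambda>n. flow_power (top_of_set points) T n x))"
    by (rule closure_mono)
  then have "range point \<subseteq> closure (points \<inter> range (\<lambda>n. flow_power (top_of_set points) T n x))"
    using point_in_orbit_closure[OF x] by blast
  then have "points \<subseteq> closure (points \<inter> range (\<lambda>n. flow_power (top_of_set points) T n x))"
    unfolding points_def by (rule closure_minimal) simp
  then show "top_of_set points closure_of range (\<lambda>n. flow_power (top_of_set points) T n x) = topspace (top_of_set points)"
    by (simp add: closure_of_subtopology Int_absorb2)
qed

theorem strictly_ergodic_points: "strictly_ergodic (top_of_set (closure (range (\<lambda>n i. h i n)))) T"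
  using uniquely_ergodic_points minimal_points
  by (simp add: strictly_ergodic_def points_def point_def)

end

section \<open>Multiplicative functionals as limits of evaluations\<close>

text \<open>With an upper bound \<open>C\<close> for \<open>g\<close>, the geometric series of \<open>1 - g / C\<close> converges uniformly to
  \<open>C / g\<close>.\<close>

lemma T_subalgebra_inverse:
  assumes A: "T_subalgebra A" and g: "(\<lambda>n. complex_of_real (g n)) \<in> A"
    and d: "d > 0" "\<And>n. d \<le> g n"
  shows "(\<lambda>n. complex_of_real (1 / g n)) \<in> A"
proof -
  obtain C where C: "\<And>n. cmod (complex_of_real (g n)) \<le> C"
    using linfE[of "\<lambda>n. complex_of_real (g n)"] T_subalgebra_subset_linf[OF A] g by blast
  have gC: "g n \<le> C" for n using C[of n] by simp
  have C0: "C > 0" using gC[of 0] d(2)[of 0] d(1) by linarith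
  have gpos: "g n > 0" for n using d(1) d(2)[of n] by linarith
  define r where "r n = 1 - g n / C" for n
  define q where "q = 1 - d / C"
  have r: "0 \<le> r n" "r n \<le> q" for n
    using gC[of n] d(2)[of n] C0 by (simp_all add: r_def q_def divide_right_mono)
  have q1: "0 \<le> q" "q < 1"
    using order_trans[OF r(1)[of 0] r(2)[of 0]] r(2)[of 0] d(1) C0 by (simp_all add: q_def)
  define F where "F N n = complex_of_real (1 / C * (\<Sum>j<N. r n ^ j))" for N n
  have F_eq: "F N n = complex_of_real ((1 - r n ^ N) / g n)" for N n
  proof -
    have "(\<Sum>j<N. r n ^ j) = (1 - r n ^ N) / (g n / C)"
      using gpos[of n] C0 by (subst sum_gp_strict) (simp add: r_def)
    then show ?thesis using C0 by (simp add: F_def)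
  qed
  have rA: "(\<lambda>n. complex_of_real (r n)) \<in> A"
    using T_subalgebra_add[OF A T_subalgebra_const[OF A, of 1] T_subalgebra_cmult[OF A g, of "- 1 / C"]]
    by (simp add: r_def)
  show ?thesis
  proof (rule T_subalgebra_uniform_limit[OF A])
    show "F N \<in> A" for N
    proof -
      have "(\<lambda>n. complex_of_real (1 / C) * (\<Sum>j<N. complex_of_real (r n) ^ j)) \<in> A"
        by (intro T_subalgebra_cmult[OF A] T_subalgebra_sum[OF A] T_subalgebra_power[OF A] rA) simp
      then show ?thesis by (simp add: F_def[abs_def])
    qed
    show "uniform_limit UNIV F (\<lambda>n. complex_of_real (1 / g n)) sequentially"
    proof (rule uniform_limitI)
      fix e :: real assume e: "e > 0"
      have "(\<lambda>N. q ^ N) \<longlonglongrightarrow> 0" using q1 by (intro LIMSEQ_power_zero) simp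
      from order_tendstoD(2)[OF this, of "e * d"] e d(1)
      have "\<forall>\<^sub>F N in sequentially. q ^ N < e * d" by simp
      then show "\<forall>\<^sub>F N in sequentially. \<forall>n\<in>UNIV. dist (F N n) (complex_of_real (1 / g n)) < e"
      proof eventually_elim
        case (elim N)
        show ?case
        proof
          fix n
          have "F N n - complex_of_real (1 / g n) = complex_of_real (- (r n ^ N) / g n)"
            unfolding F_eq by (simp add: diff_divide_distrib)
          then have "dist (F N n) (complex_of_real (1 / g n)) = r n ^ N / g n"
            using r(1)[of n] gpos[of n] by (simp only: dist_norm norm_of_real) (simp add: abs_mult)
          also have "\<dots> \<le> q ^ N / d"
            using r[of n] d q1 gpos[of n] by (intro frac_le power_mono) auto
          also have "\<dots> < e" using elim d(1) by (simp add: pos_divide_less_eq)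
          finally show "dist (F N n) (complex_of_real (1 / g n)) < e" .
        qed
      qed
    qed
  qed
qed

context
  fixes A :: "(int \<Rightarrow> complex) set" and \<phi>
  assumes A: "T_subalgebra A" and \<phi>: "\<phi> \<in> multiplicative_functionals A"
begin

lemma functional_add: "f \<in> A \<Longrightarrow> g \<in> A \<Longrightarrow> \<phi> (\<lambda>n. f n + g n) = \<phi> f + \<phi> g"
  and functional_cmult: "f \<in> A \<Longrightarrow> \<phi> (\<lambda>n. c * f n) = c * \<phi> f"
  and functional_mult: "f \<in> A \<Longrightarrow> g \<in> A \<Longrightarrow> \<phi> (\<lambda>n. f n * g n) = \<phi> f * \<phi> g"
  using \<phi> unfolding multiplicative_functionals_def by blast+

lemma functional_const: "\<phi> (\<lambda>_. c) = c"
proof -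
  obtain f where f: "f \<in> A" "\<phi> f \<noteq> 0"
    using \<phi> unfolding multiplicative_functionals_def by blast
  have "\<phi> f = \<phi> f * \<phi> (\<lambda>_. 1)"
    using functional_mult[OF f(1) T_subalgebra_const[OF A, of 1]] by simp
  then have "\<phi> (\<lambda>_. 1) = 1" using f(2) by simp
  then show ?thesis
    using functional_cmult[OF T_subalgebra_const[OF A, of 1], of c] by simp
qed

lemma functional_sum:
  assumes "finite I" "\<And>i. i \<in> I \<Longrightarrow> f i \<in> A"
  shows "\<phi> (\<lambda>n. \<Sum>i\<in>I. f i n) = (\<Sum>i\<in>I. \<phi> (f i))"
  using assms
  by (induction I rule: finite_induct)
     (simp_all add: functional_const functional_add T_subalgebra_sum[OF A])

text \<open>Otherwise \<open>g = (\<Sum>f\<in>F. |f - \<phi> f|\<^sup>2)\<close> would be bounded below by \<open>e\<^sup>2\<close> and hence invertible in the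
  algebra, although \<open>\<phi>\<close> annihilates it. Indeed \<open>|f - \<phi> f|\<^sup>2\<close> is the product of \<open>f - \<phi> f\<close>, on which
  \<open>\<phi>\<close> vanishes, with its conjugate.\<close>

lemma functional_approximated_by_evaluation:
  assumes F: "finite F" "F \<subseteq> A" and e: "e > 0"
  shows "\<exists>n. \<forall>f\<in>F. cmod (f n - \<phi> f) < e"
proof (rule ccontr)
  assume neg: "\<not> ?thesis"
  define g where "g n = (\<Sum>f\<in>F. (cmod (f n - \<phi> f))\<^sup>2)" for n
  have g_lower: "e\<^sup>2 \<le> g n" for n
  proof -
    obtain f where f: "f \<in> F" "e \<le> cmod (f n - \<phi> f)"
      using neg by (meson not_less)
    have "e\<^sup>2 \<le> (cmod (f n - \<phi> f))\<^sup>2"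
      using f(2) e by (intro power_mono) auto
    also have "\<dots> \<le> g n"
      unfolding g_def using f(1) F(1) by (intro member_le_sum) auto
    finally show ?thesis .
  qed
  define D where "D f n = f n - \<phi> f" for f n
  have DA: "D f \<in> A" and \<phi>D: "\<phi> (D f) = 0" if f: "f \<in> F" for f
  proof -
    have fA: "f \<in> A" using f F(2) by auto
    have D: "D f = (\<lambda>n. f n + - \<phi> f)" by (simp add: fun_eq_iff D_def)
    show "D f \<in> A" unfolding D by (rule T_subalgebra_add[OF A fA T_subalgebra_const[OF A]])
    show "\<phi> (D f) = 0"
      unfolding D functional_add[OF fA T_subalgebra_const[OF A]] functional_const by simp
  qed
  have g_eq: "(\<lambda>n. complex_of_real (g n)) = (\<lambda>n. \<Sum>f\<in>F. D f n * cnj (D f n))"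
    by (simp only: g_def of_real_sum complex_norm_square D_def)
  have prodA: "(\<lambda>n. D f n * cnj (D f n)) \<in> A" if "f \<in> F" for f
    by (intro T_subalgebra_mult[OF A] T_subalgebra_cnj[OF A] DA that)
  have gA: "(\<lambda>n. complex_of_real (g n)) \<in> A"
    unfolding g_eq by (rule T_subalgebra_sum[OF A F(1) prodA])
  have "\<phi> (\<lambda>n. complex_of_real (g n)) = (\<Sum>f\<in>F. \<phi> (\<lambda>n. D f n * cnj (D f n)))"
    unfolding g_eq by (rule functional_sum[OF F(1) prodA])
  also have "\<dots> = 0"
    using functional_mult[OF DA T_subalgebra_cnj[OF A DA]] \<phi>D by simp
  finally have g0: "\<phi> (\<lambda>n. complex_of_real (g n)) = 0" .
  have inv: "(\<lambda>n. complex_of_real (1 / g n)) \<in> A"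
    by (rule T_subalgebra_inverse[OF A gA _ g_lower]) (use e in simp)
  have "g n \<noteq> 0" for n using g_lower[of n] e by (metis not_less zero_less_power)
  then have "(\<lambda>n. complex_of_real (g n) * complex_of_real (1 / g n)) = (\<lambda>_. 1)"
    by (simp add: fun_eq_iff)
  then have "1 = \<phi> (\<lambda>n. complex_of_real (g n)) * \<phi> (\<lambda>n. complex_of_real (1 / g n))"
    using functional_mult[OF gA inv] functional_const[of 1] by simp
  then show False by (simp add: g0)
qed

end

text \<open>The conditions defining a multiplicative functional are closed and hold for evaluations; the
  nonvanishing condition becomes closed when it is read as \<open>\<phi> 1 = 1\<close>.\<close>

theorem multiplicative_functionals_eq_closure:
  assumes A: "T_subalgebra A"
  shows "multiplicative_functionals A = closure (range (\<lambda>n. \<lambda>f\<in>A. f n))"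
proof
  show "multiplicative_functionals A \<subseteq> closure (range (\<lambda>n. \<lambda>f\<in>A. f n))"
  proof
    fix \<phi> assume \<phi>: "\<phi> \<in> multiplicative_functionals A"
    then have ext: "\<phi> f = undefined" if "f \<notin> A" for f
      using that by (auto simp: multiplicative_functionals_def extensional_def)
    show "\<phi> \<in> closure (range (\<lambda>n. \<lambda>f\<in>A. f n))"
      unfolding closure_fun_iff
    proof (intro allI impI)
      fix I :: "(int \<Rightarrow> complex) set" and e :: real assume I: "finite I \<and> e > 0"
      then obtain n where n: "\<And>f. f \<in> I \<inter> A \<Longrightarrow> cmod (f n - \<phi> f) < e"
        using functional_approximated_by_evaluation[OF A \<phi>, of "I \<inter> A" e] by auto
      have "dist ((\<lambda>f\<in>A. f n) f) (\<phi> f) < e" if "f \<in> I" for f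
        using n[of f] ext[of f] that I by (cases "f \<in> A") (auto simp: dist_norm)
      then show "\<exists>s\<in>range (\<lambda>n. \<lambda>f\<in>A. f n). \<forall>f\<in>I. dist (s f) (\<phi> f) < e" by blast
    qed
  qed
  have "closure (range (\<lambda>n. \<lambda>f\<in>A. f n)) \<subseteq> {\<phi>. P \<phi>}"
    if "closed {\<phi>. P \<phi>}" "\<And>n. P (\<lambda>f\<in>A. f n)" for P
    by (rule closure_minimal[OF _ that(1)]) (use that(2) in auto)
  then have lim: "P \<phi>" if "\<phi> \<in> closure (range (\<lambda>n. \<lambda>f\<in>A. f n))" "closed {\<phi>. P \<phi>}" "\<And>n. P (\<lambda>f\<in>A. f n)" for P \<phi>
    using that by blast
  show "closure (range (\<lambda>n. \<lambda>f\<in>A. f n)) \<subseteq> multiplicative_functionals A"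
  proof
    fix \<phi> assume \<phi>: "\<phi> \<in> closure (range (\<lambda>n. \<lambda>f\<in>A. f n))"
    have cl: "closed {\<phi>. G \<phi> = H \<phi>}" if "continuous_on UNIV G" "continuous_on UNIV H"
      for G H :: "((int \<Rightarrow> complex) \<Rightarrow> complex) \<Rightarrow> complex"
      using that by (rule closed_Collect_eq)
    have "\<phi> f = undefined" if "f \<notin> A" for f
      by (rule lim[OF \<phi>, of "\<lambda>\<phi>. \<phi> f = undefined"])
         (use that in \<open>auto intro!: cl continuous_intros continuous_on_coordinate\<close>)
    moreover have "\<phi> (\<lambda>n. f n + g n) = \<phi> f + \<phi> g" if "f \<in> A" "g \<in> A" for f g
      by (rule lim[OF \<phi>, of "\<lambda>\<phi>. \<phi> (\<lambda>n. f n + g n) = \<phi> f + \<phi> g"])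
         (use that T_subalgebra_add[OF A that] in \<open>auto intro!: cl continuous_intros continuous_on_coordinate\<close>)
    moreover have "\<phi> (\<lambda>n. c * f n) = c * \<phi> f" if "f \<in> A" for f c
      by (rule lim[OF \<phi>, of "\<lambda>\<phi>. \<phi> (\<lambda>n. c * f n) = c * \<phi> f"])
         (use that T_subalgebra_cmult[OF A that] in \<open>auto intro!: cl continuous_intros continuous_on_coordinate\<close>)
    moreover have "\<phi> (\<lambda>n. f n * g n) = \<phi> f * \<phi> g" if "f \<in> A" "g \<in> A" for f g
      by (rule lim[OF \<phi>, of "\<lambda>\<phi>. \<phi> (\<lambda>n. f n * g n) = \<phi> f * \<phi> g"])
         (use that T_subalgebra_mult[OF A that] in \<open>auto intro!: cl continuous_intros continuous_on_coordinate\<close>)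
    moreover have "\<phi> (\<lambda>_. 1) = 1"
      by (rule lim[OF \<phi>, of "\<lambda>\<phi>. \<phi> (\<lambda>_. 1) = 1"])
         (use T_subalgebra_const[OF A] in \<open>auto intro!: cl continuous_intros continuous_on_coordinate\<close>)
    moreover have "(\<lambda>_. 1) \<in> A" by (rule T_subalgebra_const[OF A])
    ultimately show "\<phi> \<in> multiplicative_functionals A"
      unfolding multiplicative_functionals_def extensional_def mem_Collect_eq
      by (intro conjI allI ballI bexI[of _ "\<lambda>_. 1"]) auto
  qed
qed

corollary gelfand_space_eq_top_of_set:
  assumes "T_subalgebra A"
  shows "gelfand_space A = top_of_set (closure (range (\<lambda>n. \<lambda>f\<in>A. f n)))"
  unfolding gelfand_space_def multiplicative_functionals_eq_closure[OF assms, symmetric]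
  by (rule subtopology_product_extensional) (auto simp: multiplicative_functionals_def)

section \<open>Strict ergodicity of the Weyl flows\<close>

text \<open>The coordinates are indexed by the whole type of sequences. An index outside the algebra gets
  the constant sequence \<open>undefined\<close>, which is the value that functionals take there.\<close>

lemma strictly_ergodic_weyl_gelfand_space:
  "strictly_ergodic (gelfand_space weyl_algebra) (gelfand_shift weyl_algebra)"
proof -
  let ?W = weyl_algebra
  note W = T_subalgebra_weyl_algebra
  define h where "h f = (if f \<in> ?W then f else (\<lambda>_. undefined))" for f
  define \<sigma> where "\<sigma> f = (if f \<in> ?W then (\<lambda>n. f (n + 1)) else f)" for f :: "int \<Rightarrow> complex"
  define \<tau> where "\<tau> f = (if f \<in> ?W then (\<lambda>n. f (n + -1)) else f)" for f :: "int \<Rightarrow> complex"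
  have range_h: "range (\<lambda>n f. h f n) = range (\<lambda>n. \<lambda>f\<in>?W. f n)"
    by (intro image_cong refl) (auto simp: h_def fun_eq_iff)
  have "mean_recurrent_flow ?W h \<sigma> (gelfand_shift ?W)"
  proof
    show "T_subalgebra ?W" by (rule W)
    show "\<exists>c. has_uniform_mean f c" if "f \<in> ?W" for f
      by (rule weyl_has_uniform_mean[OF that])
    show "syndetic {n. \<forall>f\<in>F. cmod (f n - f m) < e}" if "finite F" "F \<subseteq> ?W" "e > 0" for F m e
      by (rule weyl_returns_syndetic[OF that])
    show "h f \<in> ?W" for f
      by (simp add: h_def T_subalgebra_const[OF W])
    have "\<sigma> (\<tau> f) = f" "\<tau> (\<sigma> f) = f" for f
      using T_subalgebra_shift[OF W, of f 1] T_subalgebra_shift[OF W, of f "-1"]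
      by (auto simp: \<sigma>_def \<tau>_def)
    then show "bij \<sigma>" by (intro o_bij[of \<tau>]) (auto simp: fun_eq_iff)
    show "h (\<sigma> f) n = h f (n + 1)" for f n
      using T_subalgebra_shift[OF W, of f 1] by (simp add: h_def \<sigma>_def)
    fix \<phi> assume "\<phi> \<in> closure (range (\<lambda>n f. h f n))"
    then have "\<phi> \<in> multiplicative_functionals ?W"
      by (simp only: range_h multiplicative_functionals_eq_closure[OF W])
    then show "gelfand_shift ?W \<phi> = \<phi> \<circ> \<sigma>"
      by (auto simp: fun_eq_iff gelfand_shift_def \<sigma>_def multiplicative_functionals_def extensional_def)
  qed
  from mean_recurrent_flow.strictly_ergodic_points[OF this] show ?thesis
    by (simp only: gelfand_space_eq_top_of_set[OF W] range_h)
qed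

lemma strictly_ergodic_function_weyl:
  assumes f: "f \<in> weyl_algebra"
  shows "strictly_ergodic_function f"
proof -
  have "mean_recurrent_flow weyl_algebra (\<lambda>i n. f (n + i)) (\<lambda>i. i + 1) shift"
  proof
    show "T_subalgebra weyl_algebra" by (rule T_subalgebra_weyl_algebra)
    show "\<exists>c. has_uniform_mean g c" if "g \<in> weyl_algebra" for g
      by (rule weyl_has_uniform_mean[OF that])
    show "syndetic {n. \<forall>f\<in>F. cmod (f n - f m) < e}" if "finite F" "F \<subseteq> weyl_algebra" "e > 0" for F m e
      by (rule weyl_returns_syndetic[OF that])
    show "(\<lambda>n. f (n + i)) \<in> weyl_algebra" for i
      by (rule T_subalgebra_shift[OF T_subalgebra_weyl_algebra f])
    show "bij (\<lambda>i :: int. i + 1)"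
      by (rule o_bij[of "\<lambda>i. i - 1"]) (auto simp: fun_eq_iff)
    show "f (n + (i + 1)) = f (n + 1 + i)" for i n
      by (simp add: algebra_simps)
    show "shift x = x \<circ> (\<lambda>i. i + 1)" for x
      by (simp add: fun_eq_iff shift_def)
  qed
  from mean_recurrent_flow.strictly_ergodic_points[OF this] show ?thesis
    by (simp add: strictly_ergodic_function_def orbit_closure_def add.commute)
qed

theorem theorem2p6:
  shows "strictly_ergodic (gelfand_space weyl_algebra) (gelfand_shift weyl_algebra) \<and>
         (\<forall>f\<in>weyl_algebra. strictly_ergodic_function f)"
  using strictly_ergodic_weyl_gelfand_space strictly_ergodic_function_weyl by blast

end
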